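(* Let $K$ be a field, let $n\geq 3$ be an integer, let $S=K[x,y_1,\ldots,y_n,z]$, and let $$I=(y_iy_j-xz : 1\leq i<j\leq n)\subset S$$ be the join-meet ideal of the diamond lattice $D_{n+2}$. Then $\beta_{24}(S/I)>0$.
   Context: The diamond lattice $D_{n+2}$ is the lattice with $n+2$ elements $x,y_1,\ldots,y_n,z$, where $x$ is the maximum, $z$ is the minimum, and $y_1,\ldots,y_n$ are pairwise incomparable with $x>y_i>z$ for all $i$; its join-meet ideal is the ideal $I$ displayed in the claim. $S$ has the standard grading, and $\beta_{ij}(S/I)=\dim_K\operatorname{Tor}_i^S(S/I,K)_j$ denotes the graded Betti numbers. *)

theory Defs
  imports Main "HOL-Library.Cardinality" "HOL-Library.Poly_Mapping" "HOL-Library.Extended_Nat"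
begin

section \<open>Polynomial rings with the standard grading\<close>

text \<open>The polynomial ring with coefficients in \<open>'k\<close> whose variables are the elements of the
  type \<open>'v\<close>; an exponent vector is a finitely supported function \<open>'v \<Rightarrow>\<^sub>0 nat\<close>.\<close>

type_synonym ('v, 'k) mpoly = "('v \<Rightarrow>\<^sub>0 nat) \<Rightarrow>\<^sub>0 'k"

definition Var :: "'v \<Rightarrow> ('v, 'k::comm_ring_1) mpoly" where
  "Var v = Poly_Mapping.single (Poly_Mapping.single v 1) 1"

definition mdeg :: "('v \<Rightarrow>\<^sub>0 nat) \<Rightarrow> nat" where
  "mdeg m = (\<Sum>v\<in>Poly_Mapping.keys m. Poly_Mapping.lookup m v)"

text \<open>The graded component of degree \<open>d\<close>; it is zero for negative \<open>d\<close>.\<close>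

definition homog :: "int \<Rightarrow> ('v, 'k::zero) mpoly set" where
  "homog d = {p. \<forall>m\<in>Poly_Mapping.keys p. int (mdeg m) = d}"

definition const_mpoly :: "'k::zero \<Rightarrow> ('v, 'k) mpoly" where
  "const_mpoly c = Poly_Mapping.single 0 c"

definition const_term :: "('v, 'k::zero) mpoly \<Rightarrow> 'k" where
  "const_term p = Poly_Mapping.lookup p 0"

definition ideal_generated :: "'r::comm_ring_1 set \<Rightarrow> 'r set" where
  "ideal_generated G = module.span (*) G"

lemma module_times: "module ((*) :: 'r::comm_ring_1 \<Rightarrow> 'r \<Rightarrow> 'r)"
  by unfold_locales (simp_all add: algebra_simps)


section \<open>Graded free resolutions\<close>

text \<open>Elements of the free module with basis \<open>B\<close> over \<open>'r\<close> are the finitely supported functions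
  \<open>'b \<Rightarrow>\<^sub>0 'r\<close> with support in \<open>B\<close>.\<close>

definition scal :: "'r::comm_ring_1 \<Rightarrow> ('b \<Rightarrow>\<^sub>0 'r) \<Rightarrow> ('b \<Rightarrow>\<^sub>0 'r)" where
  "scal r = Poly_Mapping.map ((*) r)"

lemma lookup_scal [simp]: "Poly_Mapping.lookup (scal r u) b = r * Poly_Mapping.lookup u b"
  by (simp add: scal_def Poly_Mapping.map.rep_eq when_def)

lemma module_scal: "module (scal :: 'r::comm_ring_1 \<Rightarrow> ('b \<Rightarrow>\<^sub>0 'r) \<Rightarrow> ('b \<Rightarrow>\<^sub>0 'r))"
  by unfold_locales (auto intro!: poly_mapping_eqI simp: lookup_add algebra_simps)

lemma vector_space_scal:
  "vector_space (scal :: 'k::field \<Rightarrow> ('b \<Rightarrow>\<^sub>0 'k) \<Rightarrow> ('b \<Rightarrow>\<^sub>0 'k))"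
  by unfold_locales (auto intro!: poly_mapping_eqI simp: lookup_add algebra_simps)

definition free_module :: "'b set \<Rightarrow> ('b \<Rightarrow>\<^sub>0 'r::zero) set" where
  "free_module B = {u. Poly_Mapping.keys u \<subseteq> B}"

text \<open>Degree \<open>j\<close> part of the graded free module \<open>\<Oplus>\<^sub>b S(-s b)\<close>, in which the basis
  element \<open>b\<close> sits in degree \<open>s b\<close>.\<close>

definition free_part ::
    "'b set \<Rightarrow> ('b \<Rightarrow> int) \<Rightarrow> int \<Rightarrow> ('b \<Rightarrow>\<^sub>0 ('v, 'k::zero) mpoly) set" where
  "free_part B s j = {u \<in> free_module B. \<forall>b. Poly_Mapping.lookup u b \<in> homog (j - s b)}"

text \<open>The free module \<open>F\<^sub>i\<close> has basis \<open>basis F i\<close> with degrees \<open>shift F i\<close>, and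
  \<open>diff F i\<close> maps \<open>F\<^sub>i\<close> to \<open>F\<^sub>i\<^sub>-\<^sub>1\<close> for \<open>i \<ge> 1\<close>; \<open>diff F 0\<close> carries no meaning.
  Every module occurring here has a countable \<open>K\<close>-basis when there are finitely many variables,
  so natural numbers suffice to index the bases; they need not be finite.
  The augmentation \<open>F\<^sub>0 \<rightarrow> S/I\<close> is given by a lift \<open>aug F\<close> with values in \<open>S\<close>: as \<open>F\<^sub>0\<close> is free,
  every graded homomorphism to \<open>S/I\<close> has such a lift.\<close>

record (overloaded) ('v, 'k::zero) graded_free_complex =
  basis :: "nat \<Rightarrow> nat set"
  shift :: "nat \<Rightarrow> nat \<Rightarrow> int"
  diff :: "nat \<Rightarrow> (nat \<Rightarrow>\<^sub>0 ('v, 'k) mpoly) \<Rightarrow> (nat \<Rightarrow>\<^sub>0 ('v, 'k) mpoly)"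
  aug :: "(nat \<Rightarrow>\<^sub>0 ('v, 'k) mpoly) \<Rightarrow> ('v, 'k) mpoly"

definition graded_free_resolution ::
    "('v, 'k::field) graded_free_complex \<Rightarrow> ('v, 'k) mpoly set \<Rightarrow> bool" where
  "graded_free_resolution F I \<longleftrightarrow>
     \<comment> \<open>the maps are \<open>S\<close>-linear and homogeneous of degree 0\<close>
     (\<forall>i\<ge>1. module_hom scal scal (diff F i) \<and>
        (\<forall>j. diff F i ` free_part (basis F i) (shift F i) j
                \<subseteq> free_part (basis F (i - 1)) (shift F (i - 1)) j)) \<and>
     module_hom scal (*) (aug F) \<and>
     (\<forall>j. aug F ` free_part (basis F 0) (shift F 0) j \<subseteq> homog j) \<and>
     \<comment> \<open>exactness at \<open>F\<^sub>i\<close> for \<open>i \<ge> 1\<close>, at \<open>F\<^sub>0\<close>, and at \<open>S/I\<close>\<close>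
     (\<forall>i\<ge>1. {u \<in> free_module (basis F i). diff F i u = 0}
               = diff F (Suc i) ` free_module (basis F (Suc i))) \<and>
     {u \<in> free_module (basis F 0). aug F u \<in> I} = diff F 1 ` free_module (basis F 1) \<and>
     (\<forall>p. \<exists>u \<in> free_module (basis F 0). p - aug F u \<in> I)"


section \<open>Graded Betti numbers\<close>

text \<open>Dimension of the quotient \<open>Z/B\<close> of vector spaces: the cosets of the elements of \<open>C\<close> are
  pairwise distinct and form a basis of \<open>Z/B\<close>.\<close>

definition quotient_basis ::
    "('b \<Rightarrow>\<^sub>0 'k::field) set \<Rightarrow> ('b \<Rightarrow>\<^sub>0 'k) set \<Rightarrow> ('b \<Rightarrow>\<^sub>0 'k) set \<Rightarrow> bool" where
  "quotient_basis Z B C \<longleftrightarrow>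
     \<not> module.dependent scal C \<and> module.span scal C \<inter> B = {0} \<and>
     module.span scal (C \<union> B) = Z"

definition quotient_dim :: "('b \<Rightarrow>\<^sub>0 'k::field) set \<Rightarrow> ('b \<Rightarrow>\<^sub>0 'k) set \<Rightarrow> enat" where
  "quotient_dim Z B =
     (let C = (SOME C. quotient_basis Z B C) in if finite C then enat (card C) else \<infinity>)"

text \<open>For a free module \<open>F\<^sub>i\<close> with basis \<open>B\<close>, the tensor product of \<open>F\<^sub>i\<close> with \<open>K\<close> over \<open>S\<close>
  is the \<open>K\<close>-vector space with basis \<open>B\<close>; here all variables act on \<open>K\<close> as zero, and \<open>u \<otimes> 1\<close> is
  obtained from \<open>u\<close> by taking constant terms of the coefficients. The residue field \<open>K\<close> sits
  in degree 0, so basis elements keep their degrees.\<close>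

definition tensor_part ::
    "('v, 'k::field) graded_free_complex \<Rightarrow> nat \<Rightarrow> int \<Rightarrow> (nat \<Rightarrow>\<^sub>0 'k) set" where
  "tensor_part F i j = free_module {b \<in> basis F i. shift F i b = j}"

definition tensor_diff ::
    "('v, 'k::field) graded_free_complex \<Rightarrow> nat \<Rightarrow> (nat \<Rightarrow>\<^sub>0 'k) \<Rightarrow> (nat \<Rightarrow>\<^sub>0 'k)" where
  "tensor_diff F i a =
     Poly_Mapping.map const_term (diff F i (Poly_Mapping.map const_mpoly a))"

definition tor_cycles ::
    "('v, 'k::field) graded_free_complex \<Rightarrow> nat \<Rightarrow> int \<Rightarrow> (nat \<Rightarrow>\<^sub>0 'k) set" where
  "tor_cycles F i j = {a \<in> tensor_part F i j. i = 0 \<or> tensor_diff F i a = 0}"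

definition tor_boundaries ::
    "('v, 'k::field) graded_free_complex \<Rightarrow> nat \<Rightarrow> int \<Rightarrow> (nat \<Rightarrow>\<^sub>0 'k) set" where
  "tor_boundaries F i j = tensor_diff F (Suc i) ` tensor_part F (Suc i) j"

text \<open>\<open>graded_betti I i j\<close> is \<open>\<beta>\<^sub>i\<^sub>j(S/I)\<close>, the \<open>K\<close>-dimension of the degree \<open>j\<close> part of the
  \<open>i\<close>-th Tor of \<open>S/I\<close> and \<open>K\<close> over \<open>S\<close>, computed from a graded free resolution of \<open>S/I\<close>;
  it is meaningful for homogeneous ideals \<open>I\<close>.\<close>

definition graded_betti :: "('v::finite, 'k::field) mpoly set \<Rightarrow> nat \<Rightarrow> int \<Rightarrow> enat" where
  "graded_betti I i j =
     (let F = (SOME F. graded_free_resolution F I)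
      in quotient_dim (tor_cycles F i j) (tor_boundaries F i j))"


section \<open>The diamond lattice\<close>

text \<open>With \<open>CARD('n) = n\<close> this is the lattice \<open>D\<^sub>n\<^sub>+\<^sub>2\<close>: maximum \<open>DX\<close>, minimum \<open>DZ\<close>, and pairwise
  incomparable elements \<open>DY i\<close>.\<close>

datatype 'n diamond = DX | DY 'n | DZ

instance diamond :: (finite) finite
proof
  have "(UNIV :: 'a diamond set) = insert DX (insert DZ (DY ` UNIV))"
    by (auto intro: diamond.exhaust)
  then show "finite (UNIV :: 'a diamond set)"
    by (metis finite_class.finite_UNIV finite_imageI finite_insert)
qed

instantiation diamond :: (type) lattice
begin

definition less_eq_diamond :: "'a diamond \<Rightarrow> 'a diamond \<Rightarrow> bool" where
  "a \<le> b \<longleftrightarrow> a = b \<or> a = DZ \<or> b = DX"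

definition less_diamond :: "'a diamond \<Rightarrow> 'a diamond \<Rightarrow> bool" where
  "a < b \<longleftrightarrow> a \<le> b \<and> a \<noteq> (b :: 'a diamond)"

definition sup_diamond :: "'a diamond \<Rightarrow> 'a diamond \<Rightarrow> 'a diamond" where
  "sup a b = (if a \<le> b then b else if b \<le> a then a else DX)"

definition inf_diamond :: "'a diamond \<Rightarrow> 'a diamond \<Rightarrow> 'a diamond" where
  "inf a b = (if a \<le> b then a else if b \<le> a then b else DZ)"

instance
  by standard
    (auto simp: less_eq_diamond_def less_diamond_def sup_diamond_def inf_diamond_def
      split: if_splits)

end

definition join_meet_ideal :: "('l::lattice, 'k::field) mpoly set" where
  "join_meet_ideal = ideal_generated
     {Var a * Var b - Var (sup a b) * Var (inf a b) | a b. \<not> a \<le> b \<and> \<not> b \<le> a}"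

lemma join_meet_ideal_diamond:
  "(join_meet_ideal :: ('n diamond, 'k::field) mpoly set) =
     ideal_generated {Var (DY i) * Var (DY j) - Var DX * Var DZ | i j. i \<noteq> j}"
proof -
  have incomparable: "(\<not> a \<le> b \<and> \<not> b \<le> a) \<longleftrightarrow> (\<exists>i j. a = DY i \<and> b = DY j \<and> i \<noteq> j)"
    for a b :: "'n diamond"
    by (cases a; cases b) (simp_all add: less_eq_diamond_def eq_commute)
  have sup_inf: "sup (DY i) (DY j) = DX" "inf (DY i) (DY j) = DZ" if "i \<noteq> j" for i j :: 'n
    using that by (simp_all add: less_eq_diamond_def sup_diamond_def inf_diamond_def)
  have
    "{Var a * Var b - Var (sup a b) * Var (inf a b) | a b. \<not> a \<le> b \<and> \<not> b \<le> a} =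
     ({Var (DY i) * Var (DY j) - Var DX * Var DZ | i j. i \<noteq> j} :: ('n diamond, 'k) mpoly set)"
    (is "?L = ?R")
  proof (intro equalityI subsetI)
    fix p assume "p \<in> ?L"
    then obtain a b where p: "p = Var a * Var b - Var (sup a b) * Var (inf a b)"
      and ab: "\<not> a \<le> b \<and> \<not> b \<le> a" by blast
    from ab obtain i j where "a = DY i" "b = DY j" "i \<noteq> j"
      unfolding incomparable by blast
    with p have "p = Var (DY i) * Var (DY j) - Var DX * Var DZ"
      using sup_inf[of i j] by simp
    with \<open>i \<noteq> j\<close> show "p \<in> ?R" by blast
  next
    fix p assume "p \<in> ?R"
    then obtain i j :: 'n where p: "p = Var (DY i) * Var (DY j) - Var DX * Var DZ" and "i \<noteq> j"
      by blast
    then have "p = Var (DY i) * Var (DY j) - Var (sup (DY i) (DY j)) * Var (inf (DY i) (DY j))"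
      using sup_inf[of i j] by simp
    moreover have "\<not> DY i \<le> DY j \<and> \<not> DY j \<le> DY i"
      using \<open>i \<noteq> j\<close> unfolding incomparable by blast
    ultimately show "p \<in> ?L" by blast
  qed
  then show ?thesis
    by (simp add: join_meet_ideal_def)
qed

end

theory Submission
  imports Defs
begin

text \<open>
  Write \<open>f\<^sub>i\<^sub>j = y\<^sub>iy\<^sub>j - xz\<close>. In homological degree 2 a Koszul syzygy between two of these quadrics,
  such as \<open>f\<^sub>i\<^sub>k e\<^sub>i\<^sub>j - f\<^sub>i\<^sub>j e\<^sub>i\<^sub>k\<close>, has degree 4; the claim is that it is not a combination, with
  coefficients in the maximal ideal, of syzygies of lower degree. The reason is that the coefficients
  of a syzygy miss three monomials. Let \<open>\<Sum> p\<^sub>a\<^sub>b f\<^sub>a\<^sub>b = 0\<close>, let \<open>e\<close> be \<open>1\<close>, \<open>x\<close> or \<open>z\<close>, and compare coefficients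
  of \<open>y\<^sub>iy\<^sub>j e\<close>: the monomial \<open>xz\<close> does not divide it, and \<open>y\<^sub>ay\<^sub>b\<close> divides it only for \<open>{a, b} = {i, j}\<close>, so
  the coefficient of \<open>e\<close> in \<open>p\<^sub>i\<^sub>j\<close> is zero (lemma \<open>other_binomials_colon\<close>, in the form of a statement
  about \<open>J : f\<^sub>i\<^sub>j\<close>, where \<open>J\<close> is generated by the \<open>f\<^sub>a\<^sub>b\<close> with \<open>{a, b} \<noteq> {i, j}\<close>). Since \<open>x\<close> and \<open>z\<close> are the only proper
  nontrivial divisors of \<open>xz\<close>, the monomial \<open>xz\<close> cannot occur in \<open>p\<^sub>i\<^sub>j\<close> for any element of the
  maximal ideal times the syzygies. It does occur in the coefficient \<open>f\<^sub>i\<^sub>k\<close> of the Koszul syzygy.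

  The Betti number is defined through an arbitrary graded free resolution \<open>F\<close>, which need not be
  minimal, so the argument is carried out inside \<open>F\<close>. There the Koszul syzygy becomes
  \<open>t = f\<^sub>i\<^sub>k w - f\<^sub>i\<^sub>j w'\<close>, where \<open>w\<close> and \<open>w'\<close> lift \<open>f\<^sub>i\<^sub>j\<close> and \<open>f\<^sub>i\<^sub>k\<close> to \<open>F\<^sub>1\<close>, and \<open>t\<close> is the image of an element \<open>u\<close>
  of degree 4 in \<open>F\<^sub>2\<close>. If the Tor in question vanished, \<open>u\<close> could be changed by a boundary so that all its
  coefficients have constant term zero (lemma \<open>tor_zero_lift\<close>); this is the precise sense in which
  \<open>t\<close> would lie in the maximal ideal times the syzygies. A linear map \<open>\<psi>\<close> from \<open>F\<^sub>1\<close> to \<open>S\<close>, which reads off the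
  coefficient of \<open>f\<^sub>i\<^sub>j\<close>, then gives two values for the coefficient of \<open>xz\<close> in \<open>\<psi> t\<close>, namely 0 and -1
  (lemma \<open>diamond_tor_nonzero\<close>).

  Since the resolution is obtained by a choice operator, its existence has to be established too
  (lemma \<open>graded_free_resolution_exists\<close>). Every graded submodule \<open>N\<close> of a free module with countable
  basis has a countable set of homogeneous generators: order the monomials of the free module in type
  \<open>\<omega>\<close>, choose for every leading monomial that occurs in \<open>N\<close> one homogeneous element of \<open>N\<close>, and
  reduce (lemma \<open>graded_submodule_generators\<close>). Iterating over kernels gives the resolution. In the
  same way the dimension of a quotient is measured by a chosen basis, whose existence is part of
  lemma \<open>quotient_dim_pos\<close>.
\<close>

section \<open>Linear maps on free modules\<close>

abbreviation coeff where "coeff \<equiv> Poly_Mapping.lookup"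
abbreviation monom where "monom \<equiv> Poly_Mapping.single"

text \<open>The linear map with value \<open>g b\<close> on the basis element \<open>b\<close>. The scalar multiplication \<open>s\<close> of the
  target is a parameter, so that the target can be a free module or the ring itself.\<close>

definition lin_ext :: "('r \<Rightarrow> 'm::comm_monoid_add \<Rightarrow> 'm) \<Rightarrow> ('b \<Rightarrow> 'm) \<Rightarrow> ('b \<Rightarrow>\<^sub>0 'r::comm_ring_1) \<Rightarrow> 'm" where
  "lin_ext s g u = (\<Sum>b\<in>Poly_Mapping.keys u. s (coeff u b) (g b))"

lemma poly_mapping_sum_single: "u = (\<Sum>b\<in>Poly_Mapping.keys u. monom b (coeff u b))"
  by (rule poly_mapping_eqI)
    (simp add: lookup_sum lookup_single when_def in_keys_iff if_distrib sum.delta cong: if_cong)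

lemma lin_ext_superset:
  assumes "module s" "finite A" "Poly_Mapping.keys u \<subseteq> A"
  shows "lin_ext s g u = (\<Sum>b\<in>A. s (coeff u b) (g b))"
proof -
  interpret module s by fact
  show ?thesis unfolding lin_ext_def
    by (rule sum.mono_neutral_left) (use assms in \<open>auto simp: in_keys_iff\<close>)
qed

lemma keys_scal: "Poly_Mapping.keys (scal r u) \<subseteq> Poly_Mapping.keys u"
  by (auto simp: in_keys_iff)

lemma lin_ext_hom:
  fixes s :: "'r::comm_ring_1 \<Rightarrow> 'm::ab_group_add \<Rightarrow> 'm" and g :: "'b \<Rightarrow> 'm"
  assumes "module s"
  shows "module_hom scal s (lin_ext s g)"
proof -
  interpret module s by fact
  interpret f: module "scal :: 'r \<Rightarrow> ('b \<Rightarrow>\<^sub>0 'r) \<Rightarrow> _" by (rule module_scal)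
  have add: "lin_ext s g (u + v) = lin_ext s g u + lin_ext s g v" for u v
  proof -
    let ?A = "Poly_Mapping.keys u \<union> Poly_Mapping.keys v"
    have "Poly_Mapping.keys (u + v) \<subseteq> ?A" by (rule keys_add)
    then show ?thesis
      by (simp add: lin_ext_superset[OF assms, of ?A] lookup_add scale_left_distrib sum.distrib)
  qed
  have scl: "lin_ext s g (scal r u) = s r (lin_ext s g u)" for r u
    using keys_scal[of r u]
    by (simp add: lin_ext_superset[OF assms, of "Poly_Mapping.keys u"] scale_sum_right)
  show ?thesis
    by unfold_locales (simp_all add: add scl)
qed

lemma lin_ext_single:
  assumes "module s"
  shows "lin_ext s g (monom b r) = s r (g b)"
proof -
  interpret module s by fact
  show ?thesis by (simp add: lin_ext_def)
qed

lemma scal_single: "scal r (monom b c) = monom b (r * c)"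
  by (rule poly_mapping_eqI) (simp add: lookup_single when_def)

lemma hom_eq_lin_ext:
  assumes "module_hom scal s d"
  shows "d u = lin_ext s (\<lambda>b. d (monom b 1)) u"
proof -
  interpret module_hom scal s d by fact
  have "d u = d (\<Sum>b\<in>Poly_Mapping.keys u. scal (coeff u b) (monom b 1))"
    using poly_mapping_sum_single[of u] by (simp add: scal_single)
  then show ?thesis by (simp add: sum scale lin_ext_def)
qed

lemma subspace_free_module: "module.subspace scal (free_module B)"
proof -
  interpret f: module scal by (rule module_scal)
  show ?thesis unfolding f.subspace_def free_module_def
    by (auto dest!: subsetD[OF keys_add] subsetD[OF keys_scal])
qed

text \<open>A free module over a polynomial ring is additively generated by monomials times basis elements;
  as these are homogeneous, additive identities between graded pieces reduce to this case.\<close>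

lemma free_module_induct [consumes 1, case_names zero add monom]:
  fixes u :: "'b \<Rightarrow>\<^sub>0 ('v, 'k::comm_ring_1) mpoly"
  assumes "u \<in> free_module B" "P 0" "\<And>u v. P u \<Longrightarrow> P v \<Longrightarrow> P (u + v)"
    "\<And>b m c. b \<in> B \<Longrightarrow> P (monom b (monom m c))"
  shows "P u"
proof -
  \<comment> \<open>once for sums over exponent vectors, once for sums over basis elements\<close>
  have P_sum: "P (sum f A)" if "\<And>a. a \<in> A \<Longrightarrow> P (f a)" "finite A"
    for f :: "'z \<Rightarrow> _" and A
    using that(2,1) by induction (auto intro: assms)
  have P_sum': "P (sum f A)" if "\<And>a. a \<in> A \<Longrightarrow> P (f a)" "finite A"
    for f :: "'b \<Rightarrow> _" and A
    using that(2,1) by induction (auto intro: assms)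
  have "P (monom b p)" if "b \<in> B" for b p
  proof -
    have "monom b p = (\<Sum>m\<in>Poly_Mapping.keys p. monom b (monom m (coeff p m)))"
      by (subst poly_mapping_sum_single[of p], rule poly_mapping_eqI)
        (simp add: lookup_sum lookup_single when_def)
    also have "P \<dots>" by (rule P_sum) (use that assms in auto)
    finally show ?thesis .
  qed
  then have "P (\<Sum>b\<in>Poly_Mapping.keys u. monom b (coeff u b))"
    using assms(1) by (intro P_sum') (auto simp: free_module_def)
  then show ?thesis using poly_mapping_sum_single[of u] by simp
qed

section \<open>Coefficients of products\<close>

lemma mdeg_sum: "mdeg m = (\<Sum>v\<in>UNIV. coeff m (v::'v::finite))"
  unfolding mdeg_def by (rule sum.mono_neutral_left) (auto simp: in_keys_iff)

lemma mdeg_add: "mdeg (m + m') = mdeg m + mdeg (m' :: 'v::finite \<Rightarrow>\<^sub>0 nat)"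
  by (simp add: mdeg_sum lookup_add sum.distrib)

lemma mdeg_eq_0 [simp]: "mdeg (m :: 'v::finite \<Rightarrow>\<^sub>0 nat) = 0 \<longleftrightarrow> m = 0"
  by (auto simp: mdeg_sum poly_mapping_eq_iff fun_eq_iff)

lemma coeff_monom_mult_add:
  fixes q :: "('v, 'k::comm_ring_1) mpoly"
  shows "coeff (monom m c * q) (m + m') = c * coeff q m'"
proof -
  have "monom m c * q = (\<Sum>k\<in>Poly_Mapping.keys q. monom (m + k) (c * coeff q k))"
    by (simp only: mult_single[symmetric] sum_distrib_left[symmetric] poly_mapping_sum_single[symmetric])
  then show ?thesis
    by (simp add: lookup_sum lookup_single when_def in_keys_iff if_distrib sum.delta cong: if_cong)
qed

lemma coeff_monom_mult_other:
  fixes q :: "('v, 'k::comm_ring_1) mpoly"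
  assumes "\<And>m'. k \<noteq> m + m'"
  shows "coeff (monom m c * q) k = 0"
proof -
  have "monom m c * q = (\<Sum>k\<in>Poly_Mapping.keys q. monom (m + k) (c * coeff q k))"
    by (simp only: mult_single[symmetric] sum_distrib_left[symmetric] poly_mapping_sum_single[symmetric])
  moreover have "m + m' \<noteq> k" for m' using assms[of m'] by blast
  ultimately show ?thesis by (simp add: lookup_sum lookup_single)
qed

lemma coeff_mult_eq_0:
  fixes p q :: "('v, 'k::comm_ring_1) mpoly"
  assumes "\<And>m m'. k = m + m' \<Longrightarrow> coeff p m = 0 \<or> coeff q m' = 0"
  shows "coeff (p * q) k = 0"
proof -
  have "p * q = (\<Sum>m\<in>Poly_Mapping.keys p. monom m (coeff p m) * q)"
    by (simp only: sum_distrib_right[symmetric] poly_mapping_sum_single[symmetric])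
  moreover have "coeff (monom m (coeff p m) * q) k = 0" for m
  proof (cases "\<exists>m'. k = m + m'")
    case True
    then obtain m' where "k = m + m'" ..
    then show ?thesis using assms[of m m'] by (auto simp: coeff_monom_mult_add)
  next
    case False
    then show ?thesis by (auto intro: coeff_monom_mult_other)
  qed
  ultimately show ?thesis by (simp add: lookup_sum)
qed

lemma const_term_mult:
  fixes p q :: "('v::finite, 'k::comm_ring_1) mpoly"
  shows "const_term (p * q) = const_term p * const_term q"
proof -
  have "const_term ((p - monom 0 (const_term p)) * q) = 0"
    unfolding const_term_def
  proof (rule coeff_mult_eq_0)
    fix m m' :: "'v \<Rightarrow>\<^sub>0 nat" assume "0 = m + m'"
    then have "m = 0"
      by (auto simp: poly_mapping_eq_iff fun_eq_iff lookup_add)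
    then show "coeff (p - monom 0 (coeff p 0)) m = 0 \<or> coeff q m' = 0"
      by (simp add: lookup_minus)
  qed
  moreover have "const_term (monom 0 (const_term p) * q) = const_term p * const_term q"
    using coeff_monom_mult_add[of 0 _ q 0] by (simp add: const_term_def)
  moreover have "p * q = (p - monom 0 (const_term p)) * q + monom 0 (const_term p) * q"
    by (simp add: left_diff_distrib)
  ultimately show ?thesis by (simp add: const_term_def lookup_add)
qed

section \<open>Homogeneous components\<close>

definition homog_part :: "int \<Rightarrow> ('v, 'k::zero) mpoly \<Rightarrow> ('v, 'k) mpoly" where
  "homog_part j p = Poly_Mapping.mapp (\<lambda>m c. if int (mdeg m) = j then c else 0) p"

definition free_homog_part :: "('b \<Rightarrow> int) \<Rightarrow> int \<Rightarrow> ('b \<Rightarrow>\<^sub>0 ('v, 'k::zero) mpoly) \<Rightarrow> ('b \<Rightarrow>\<^sub>0 ('v, 'k) mpoly)" where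
  "free_homog_part s j u = Poly_Mapping.mapp (\<lambda>b p. homog_part (j - s b) p) u"

lemma coeff_homog_part [simp]:
  "coeff (homog_part j p) m = (if int (mdeg m) = j then coeff p m else 0)"
  by (auto simp: homog_part_def lookup_mapp in_keys_iff when_def)

lemma coeff_free_homog_part [simp]:
  "coeff (free_homog_part s j u) b = homog_part (j - s b) (coeff u b)"
  by (rule poly_mapping_eqI) (auto simp: free_homog_part_def lookup_mapp in_keys_iff when_def)

lemma homog_part_add: "homog_part j (p + q) = homog_part j p + homog_part j q"
  by (rule poly_mapping_eqI) (simp add: lookup_add)

lemma free_homog_part_add:
  "free_homog_part s j (u + v) = free_homog_part s j u + free_homog_part s j v"
  by (rule poly_mapping_eqI) (simp add: lookup_add homog_part_add)

lemma homog_part_0 [simp]: "homog_part j 0 = 0" by (simp add: poly_mapping_eq_iff fun_eq_iff)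
lemma free_homog_part_0 [simp]: "free_homog_part s j 0 = 0" by (simp add: poly_mapping_eq_iff fun_eq_iff)

lemma homog_iff: "p \<in> homog j \<longleftrightarrow> (\<forall>m. coeff p m \<noteq> 0 \<longrightarrow> int (mdeg m) = j)"
  by (auto simp: homog_def in_keys_iff)

lemma homog_part_homog:
  assumes "p \<in> homog j"
  shows "homog_part i p = (if i = j then p else 0)"
  using assms by (auto simp: homog_iff poly_mapping_eq_iff fun_eq_iff)

lemma homog_part_in [simp]: "homog_part j p \<in> homog j"
  by (auto simp: homog_iff)

lemma free_homog_part_free_part:
  assumes "u \<in> free_part B s j"
  shows "free_homog_part s i u = (if i = j then u else 0)"
proof (rule poly_mapping_eqI)
  fix b
  have "coeff u b \<in> homog (j - s b)" using assms by (simp add: free_part_def)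
  then show "coeff (free_homog_part s i u) b = coeff (if i = j then u else 0) b"
    by (simp add: homog_part_homog)
qed

lemma free_homog_part_in:
  assumes "u \<in> free_module B"
  shows "free_homog_part s j u \<in> free_part B s j"
proof -
  have "b \<in> B" if "homog_part (j - s b) (coeff u b) \<noteq> 0" for b
  proof -
    have "coeff u b \<noteq> 0" using that by auto
    then show ?thesis using assms by (auto simp: free_module_def in_keys_iff)
  qed
  then have "Poly_Mapping.keys (free_homog_part s j u) \<subseteq> B"
    by (auto simp: in_keys_iff)
  then show ?thesis by (simp add: free_part_def free_module_def)
qed

lemma free_part_subset: "free_part B s j \<subseteq> free_module B"
  by (auto simp: free_part_def)

lemma homog_0 [simp]: "0 \<in> homog j"
  by (simp add: homog_iff)

lemma homog_add: "p \<in> homog j \<Longrightarrow> q \<in> homog j \<Longrightarrow> p + q \<in> homog j"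
  by (auto simp: homog_iff lookup_add) (metis add_0)

lemma homog_mult:
  fixes p q :: "('v::finite, 'k::comm_ring_1) mpoly"
  assumes "p \<in> homog i" "q \<in> homog j"
  shows "p * q \<in> homog (i + j)"
  unfolding homog_iff
proof (intro allI impI)
  fix m assume "coeff (p * q) m \<noteq> 0"
  then obtain k l where "m = k + l" "coeff p k \<noteq> 0" "coeff q l \<noteq> 0"
    using coeff_mult_eq_0[of m p q] by blast
  then show "int (mdeg m) = i + j"
    using assms by (simp add: homog_iff mdeg_add)
qed

lemma free_part_monom:
  fixes m :: "'v::finite \<Rightarrow>\<^sub>0 nat"
  assumes "b \<in> B"
  shows "monom b (monom m c) \<in> free_part B s (int (mdeg m) + s b)"
  using assms by (auto simp: free_part_def free_module_def homog_iff lookup_single when_def)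

lemma free_part_0 [simp]: "0 \<in> free_part B s j"
  by (simp add: free_part_def free_module_def)

lemma free_part_add: "u \<in> free_part B s j \<Longrightarrow> v \<in> free_part B s j \<Longrightarrow> u + v \<in> free_part B s j"
  using keys_add[of u v] by (auto simp: free_part_def free_module_def lookup_add homog_add)

lemma free_part_scal:
  fixes u :: "'b \<Rightarrow>\<^sub>0 ('v::finite, 'k::comm_ring_1) mpoly"
  assumes "p \<in> homog i" "u \<in> free_part B s j"
  shows "scal p u \<in> free_part B s (i + j)"
proof -
  have "p * coeff u b \<in> homog (i + j - s b)" for b
    using homog_mult[OF assms(1), of "coeff u b" "j - s b"] assms(2)
    by (simp add: free_part_def add_diff_eq)
  moreover have "Poly_Mapping.keys (scal p u) \<subseteq> B"
    using assms(2) keys_scal[of p u] by (auto simp: free_part_def free_module_def)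
  ultimately show ?thesis by (simp add: free_part_def free_module_def)
qed


text \<open>The target is described only by its graded pieces \<open>N\<close> and the projections \<open>part\<close>, so that the
  statement covers both maps between free modules and the augmentation, whose target is the ring. It
  makes kernels graded and lets preimages of homogeneous elements be chosen homogeneous.\<close>

lemma homogeneous_map_commutes_part:
  fixes d :: "('b \<Rightarrow>\<^sub>0 ('v::finite, 'k::comm_ring_1) mpoly) \<Rightarrow> 'm::ab_group_add"
  assumes d: "additive d" and part_add: "\<And>j x y. part j (x + y) = part j x + part j y"
    and part: "\<And>i j x. x \<in> N j \<Longrightarrow> part i x = (if i = j then x else 0)"
    and deg: "\<And>j. d ` free_part B s j \<subseteq> N j"
    and u: "u \<in> free_module B"
  shows "part j (d u) = d (free_homog_part s j u)"
  using u
proof (induction u rule: free_module_induct)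
  case zero
  have "part j (0 + 0) = part j 0 + part j 0" by (rule part_add)
  then have "part j 0 = 0" by simp
  then show ?case by (simp only: free_homog_part_0 additive.zero[OF d])
next
  case (add u v)
  then show ?case by (simp only: additive.add[OF d] part_add free_homog_part_add)
next
  case (monom b m c)
  let ?u = "monom b (monom m c)" and ?i = "int (mdeg m) + s b"
  have u: "?u \<in> free_part B s ?i" by (rule free_part_monom) fact
  then have "d ?u \<in> N ?i" using deg by blast
  then show ?case
    by (simp add: part[of _ ?i] free_homog_part_free_part[OF u] additive.zero[OF d])
qed

section \<open>Existence of graded free resolutions\<close>

lemma free_homog_part_decomp:
  fixes u :: "'b \<Rightarrow>\<^sub>0 ('v, 'k::comm_ring_1) mpoly"
  shows "\<exists>J. finite J \<and> u = (\<Sum>j\<in>J. free_homog_part s j u)"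
proof (intro exI conjI)
  let ?J = "\<Union>b\<in>Poly_Mapping.keys u. \<Union>m\<in>Poly_Mapping.keys (coeff u b). {int (mdeg m) + s b}"
  show "finite ?J" by simp
  show "u = (\<Sum>j\<in>?J. free_homog_part s j u)"
  proof (intro poly_mapping_eqI)
    fix b and m :: "'v \<Rightarrow>\<^sub>0 nat"
    have eq: "(int (mdeg m) = j - s b) = (j = int (mdeg m) + s b)" for j
      by auto
    have "int (mdeg m) + s b \<in> ?J" if "coeff (coeff u b) m \<noteq> 0"
      using that by (auto simp: in_keys_iff intro!: bexI[of _ b] bexI[of _ m])
    moreover have "coeff (coeff (\<Sum>j\<in>?J. free_homog_part s j u) b) m
        = (if int (mdeg m) + s b \<in> ?J then coeff (coeff u b) m else 0)"
      using \<open>finite ?J\<close> by (simp add: lookup_sum eq sum.delta' del: UN_iff)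
    ultimately show "coeff (coeff u b) m = coeff (coeff (\<Sum>j\<in>?J. free_homog_part s j u) b) m"
      by (metis (no_types, lifting))
  qed
qed

definition graded_submodule ::
    "'b set \<Rightarrow> ('b \<Rightarrow> int) \<Rightarrow> ('b \<Rightarrow>\<^sub>0 ('v, 'k::field) mpoly) set \<Rightarrow> bool" where
  "graded_submodule B s N \<longleftrightarrow> module.subspace scal N \<and> N \<subseteq> free_module B \<and>
     (\<forall>u\<in>N. \<forall>j. free_homog_part s j u \<in> N)"

text \<open>The monomials of the free module, that is the pairs of a basis element and an exponent vector,
  are numbered injectively by \<open>code\<close>, and the leading monomial of an element is the one with the
  largest code. One homogeneous element of \<open>N\<close> is chosen for each leading monomial that occurs; since the
  coefficients form a field, subtracting scalar multiples of these elements lowers the largest code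
  until nothing is left. Only scalars serve as multipliers, which lets an arbitrary numbering take the
  place of a monomial order; the price is that the generating set is usually infinite.\<close>

lemma graded_submodule_generators:
  fixes N :: "(nat \<Rightarrow>\<^sub>0 ('v::finite, 'k::field) mpoly) set"
  assumes N: "graded_submodule B s N"
  shows "\<exists>B' s' g. (\<forall>b\<in>B'. g b \<in> free_part B s (s' b)) \<and>
    lin_ext scal g ` free_module (B' :: nat set) = N"
proof -
  interpret M: module "scal :: _ \<Rightarrow> (nat \<Rightarrow>\<^sub>0 ('v, 'k) mpoly) \<Rightarrow> _" by (rule module_scal)
  have subN: "M.subspace N" and N_free: "N \<subseteq> free_module B"
    and N_part: "\<And>u j. u \<in> N \<Longrightarrow> free_homog_part s j u \<in> N"
    using N by (auto simp: graded_submodule_def)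
  obtain xs :: "'v list" where xs: "set xs = UNIV" using finite_list[OF finite] by blast
  define code :: "nat \<times> ('v \<Rightarrow>\<^sub>0 nat) \<Rightarrow> nat" where
    "code t = to_nat (fst t, map (coeff (snd t)) xs)" for t
  have inj: "inj code"
  proof (rule injI)
    fix t t' assume "code t = code t'"
    then have "fst t = fst t'" "\<forall>x. coeff (snd t) x = coeff (snd t') x"
      by (simp_all add: code_def xs)
    then show "t = t'" by (intro prod_eqI poly_mapping_eqI) simp_all
  qed
  define cf :: "(nat \<Rightarrow>\<^sub>0 ('v, 'k) mpoly) \<Rightarrow> nat \<times> ('v \<Rightarrow>\<^sub>0 nat) \<Rightarrow> 'k" where
    "cf u t = coeff (coeff u (fst t)) (snd t)" for u t
  have cf_scal: "cf (scal (monom 0 a) u) t = a * cf u t" for a u t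
    using coeff_monom_mult_add[of 0 a "coeff u (fst t)" "snd t"] by (simp add: cf_def)
  have cf_diff: "cf (u - v) t = cf u t - cf v t" for u v t
    by (simp add: cf_def lookup_minus)
  define deg where "deg t = int (mdeg (snd t)) + s (fst t)" for t :: "nat \<times> ('v \<Rightarrow>\<^sub>0 nat)"
  define leads where "leads u t \<longleftrightarrow> u \<in> N \<and> u \<in> free_part B s (deg t) \<and> cf u t = 1 \<and>
    (\<forall>t'. cf u t' \<noteq> 0 \<longrightarrow> code t' \<le> code t)" for u t
  define lead where "lead t = (SOME u. leads u t)" for t
  have lead: "leads (lead t) t" if "leads u t" for u t
    unfolding lead_def using that by (rule someI)
  define B' where "B' = code ` {t. \<exists>u. leads u t}"
  define s' where "s' n = deg (inv code n)" for n
  define g where "g n = lead (inv code n)" for n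
  have g_code: "g (code t) = lead t" and s'_code: "s' (code t) = deg t" for t
    using inj by (simp_all add: g_def s'_def)
  have g: "g b \<in> N \<and> g b \<in> free_part B s (s' b)" if b: "b \<in> B'" for b
  proof -
    obtain t u where t: "b = code t" "leads u t" using b by (auto simp: B'_def)
    then show ?thesis using lead[OF t(2)] by (simp add: g_code s'_code leads_def)
  qed
  interpret L: module_hom scal scal "lin_ext scal g" by (rule lin_ext_hom[OF module_scal])
  define R where "R = lin_ext scal g ` free_module B'"
  have subR: "M.subspace R"
    unfolding R_def by (rule L.subspace_image[OF subspace_free_module])
  have leadR: "lead t \<in> R" if "leads u t" for u t
  proof -
    have "code t \<in> B'" using that by (auto simp: B'_def)
    then have "monom (code t) 1 \<in> free_module B'" by (simp add: free_module_def)
    then have "lin_ext scal g (monom (code t) 1) \<in> R" unfolding R_def by (rule imageI)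
    then show ?thesis by (simp add: lin_ext_single[OF module_scal] g_code)
  qed
  have reduce: "u \<in> R" if "u \<in> N" "u \<in> free_part B s j" "\<And>t. cf u t \<noteq> 0 \<Longrightarrow> code t < k" for u j k
    using that
  proof (induction k arbitrary: u)
    case 0
    then have "coeff (coeff u b) m = 0" for b m
      using "0.prems"(3)[of "(b, m)"] by (auto simp: cf_def)
    then have "u = 0" by (auto intro!: poly_mapping_eqI)
    then show ?case using M.subspace_0[OF subR] by simp
  next
    case (Suc k)
    show ?case
    proof (cases "\<exists>t. code t = k \<and> cf u t \<noteq> 0")
      case False
      then have "code t \<noteq> k" if "cf u t \<noteq> 0" for t
        using that by blast
      then have "code t < k" if "cf u t \<noteq> 0" for t
        using Suc.prems(3)[OF that] that by (simp add: less_Suc_eq)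
      then show ?thesis using Suc.IH Suc.prems by blast
    next
      case True
      then obtain t where t: "code t = k" "cf u t \<noteq> 0" by blast
      have const: "monom 0 a \<in> (homog 0 :: ('v, 'k) mpoly set)" for a
        by (auto simp: homog_iff lookup_single when_def)
      have deg_t: "deg t = j"
      proof -
        have "coeff u (fst t) \<in> homog (j - s (fst t))"
          using Suc.prems(2) by (simp add: free_part_def)
        then show ?thesis using t(2) by (auto simp: homog_iff cf_def deg_def)
      qed
      have "leads (scal (monom 0 (inverse (cf u t))) u) t"
        unfolding leads_def cf_scal deg_t
        using free_part_scal[OF const Suc.prems(2)] Suc.prems(1,3) t M.subspace_scale[OF subN]
        by (auto simp: less_Suc_eq_le)
      then have "leads (lead t) t" and R: "lead t \<in> R" by (blast intro: lead leadR)+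
      then have l: "lead t \<in> N" "lead t \<in> free_part B s j" "cf (lead t) t = 1"
        "\<And>t'. cf (lead t) t' \<noteq> 0 \<Longrightarrow> code t' \<le> k"
        by (auto simp: leads_def deg_t t)
      define v where "v = u - scal (monom 0 (cf u t)) (lead t)"
      have "v \<in> N"
        unfolding v_def using Suc.prems(1) l(1) subN by (intro M.subspace_diff M.subspace_scale)
      moreover have "v \<in> free_part B s j"
      proof -
        have "v = u + scal (monom 0 (- cf u t)) (lead t)"
          by (simp add: v_def single_uminus M.scale_minus_left)
        then show ?thesis
          using free_part_add[OF Suc.prems(2)] free_part_scal[OF const l(2)] by simp
      qed
      moreover have "code t' < k" if "cf v t' \<noteq> 0" for t'
      proof -
        have v: "cf v t' = cf u t' - cf u t * cf (lead t) t'"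
          by (simp add: v_def cf_diff cf_scal)
        have "t' \<noteq> t" using that v l(3) by auto
        then have "code t' \<noteq> k" using inj t(1) by (auto dest: injD)
        moreover have "cf u t' \<noteq> 0 \<or> cf (lead t) t' \<noteq> 0" using that v by auto
        then have "code t' \<le> k" using Suc.prems(3)[of t'] l(4)[of t'] by auto
        ultimately show ?thesis by simp
      qed
      ultimately have "v \<in> R" by (rule Suc.IH)
      then have "v + scal (monom 0 (cf u t)) (lead t) \<in> R"
        using R by (intro M.subspace_add[OF subR] M.subspace_scale[OF subR])
      then show ?thesis by (simp add: v_def)
    qed
  qed
  have homogR: "u \<in> R" if "u \<in> N" "u \<in> free_part B s j" for u j
  proof -
    let ?T = "\<Union>b\<in>Poly_Mapping.keys u. \<Union>m\<in>Poly_Mapping.keys (coeff u b). {code (b, m)}"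
    have "finite ?T" by simp
    have "code t < Suc (Max ?T)" if "cf u t \<noteq> 0" for t
    proof -
      have "coeff u (fst t) \<noteq> 0" "coeff (coeff u (fst t)) (snd t) \<noteq> 0"
        using that by (auto simp: cf_def)
      then have "code t \<in> ?T"
        by (auto simp: in_keys_iff intro!: bexI[of _ "fst t"] bexI[of _ "snd t"])
      then show ?thesis using Max_ge[OF \<open>finite ?T\<close>] by (simp add: less_Suc_eq_le)
    qed
    then show ?thesis using reduce[OF that] by blast
  qed
  have "N \<subseteq> R"
  proof
    fix u assume u: "u \<in> N"
    obtain J where J: "u = (\<Sum>j\<in>J. free_homog_part s j u)" using free_homog_part_decomp[of u s] by blast
    have "(\<Sum>j\<in>J. free_homog_part s j u) \<in> R"
      using u N_free N_part free_homog_part_in[of u B s]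
      by (intro M.subspace_sum[OF subR] homogR) auto
    then show "u \<in> R" using J by simp
  qed
  moreover have "lin_ext scal g u \<in> N" if "u \<in> free_module B'" for u
    unfolding lin_ext_def
  proof (intro M.subspace_sum[OF subN] M.subspace_scale[OF subN])
    fix b assume "b \<in> Poly_Mapping.keys u"
    then show "g b \<in> N" using that g by (auto simp: free_module_def)
  qed
  then have "R \<subseteq> N" by (auto simp: R_def)
  ultimately have "lin_ext scal g ` free_module B' = N" unfolding R_def by (rule equalityI[rotated])
  moreover have "\<forall>b\<in>B'. g b \<in> free_part B s (s' b)" using g by simp
  ultimately show ?thesis by (intro exI[of _ B'] exI[of _ s'] exI[of _ g]) simp
qed

text \<open>A homogeneous map sends the components of an element of its kernel to the components of zero.\<close>

lemma kernel_graded_submodule: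
  fixes d :: "('b \<Rightarrow>\<^sub>0 ('v::finite, 'k::field) mpoly) \<Rightarrow> ('c \<Rightarrow>\<^sub>0 ('v, 'k) mpoly)"
  assumes d: "module_hom scal scal d"
    and deg: "\<And>j. d ` free_part B s j \<subseteq> free_part B' s' j"
  shows "graded_submodule B s {u \<in> free_module B. d u = 0}"
proof -
  interpret d: module_hom scal scal d by fact
  have add: "additive d" by (simp add: additive_def d.add)
  have part: "d (free_homog_part s j u) = free_homog_part s' j (d u)" if "u \<in> free_module B" for u j
  proof (rule homogeneous_map_commutes_part[symmetric, where N = "free_part B' s'"])
    show "x \<in> free_part B' s' k \<Longrightarrow> free_homog_part s' i x = (if i = k then x else 0)" for i k x
      by (rule free_homog_part_free_part)
  qed (fact add free_homog_part_add deg that)+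
  have "{u \<in> free_module B. d u = 0} = free_module B \<inter> {u. d u = 0}" by auto
  then have "module.subspace scal {u \<in> free_module B. d u = 0}"
    by (simp add: d.m1.subspace_inter[OF subspace_free_module d.subspace_kernel])
  moreover have "free_homog_part s j u \<in> {u \<in> free_module B. d u = 0}"
    if "u \<in> {u \<in> free_module B. d u = 0}" for u j
    using that free_homog_part_in[of u B s j] free_part_subset[of B s j] by (auto simp: part)
  ultimately show ?thesis unfolding graded_submodule_def by blast
qed

lemma graded_free_cover:
  fixes N :: "(nat \<Rightarrow>\<^sub>0 ('v::finite, 'k::field) mpoly) set"
  assumes "graded_submodule B s N"
  shows "\<exists>(B' :: nat set) s' d. module_hom scal scal d \<and>
    (\<forall>j. d ` free_part B' s' j \<subseteq> free_part B s j) \<and> d ` free_module B' = N"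
proof -
  obtain B' s' g where g: "\<And>b. b \<in> B' \<Longrightarrow> g b \<in> free_part B s (s' b)"
    and onto: "lin_ext scal g ` free_module (B' :: nat set) = N"
    using graded_submodule_generators[OF assms] by blast
  have sum: "(\<Sum>b\<in>A. f b) \<in> free_part B s j" if "\<And>b. b \<in> A \<Longrightarrow> f b \<in> free_part B s j" "finite A" for A f j
    using that(2,1) by induction (auto intro: free_part_add)
  have "lin_ext scal g u \<in> free_part B s j" if u: "u \<in> free_part B' s' j" for u j
    unfolding lin_ext_def
  proof (rule sum)
    fix b assume "b \<in> Poly_Mapping.keys u"
    then have b: "b \<in> B'" using u by (auto simp: free_part_def free_module_def)
    have "coeff u b \<in> homog (j - s' b)" using u by (simp add: free_part_def)
    from free_part_scal[OF this g[OF b]] show "scal (coeff u b) (g b) \<in> free_part B s j" by simp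
  qed simp
  then show ?thesis using lin_ext_hom[OF module_scal] onto by blast
qed

lemma graded_free_resolution_exists:
  fixes I :: "('v::finite, 'k::field) mpoly set"
  assumes I: "module.subspace (*) I" and homog: "\<And>p j. p \<in> I \<Longrightarrow> homog_part j p \<in> I"
  shows "\<exists>F. graded_free_resolution F I"
proof -
  interpret M: module "scal :: _ \<Rightarrow> (nat \<Rightarrow>\<^sub>0 ('v, 'k) mpoly) \<Rightarrow> _" by (rule module_scal)
  interpret R: module "(*) :: ('v, 'k) mpoly \<Rightarrow> _" by (rule module_times)
  define aug0 :: "(nat \<Rightarrow>\<^sub>0 ('v, 'k) mpoly) \<Rightarrow> ('v, 'k) mpoly" where "aug0 = (\<lambda>u. coeff u 0)"
  have aug0: "module_hom scal (*) aug0"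
    by unfold_locales (simp_all add: aug0_def lookup_add)
  define N0 where "N0 = {u \<in> free_module {0}. aug0 u \<in> I}"
  have "M.subspace N0"
  proof -
    have "M.subspace {u. aug0 u \<in> I}"
      using module_hom.subspace_linear_preimage[OF aug0 I] .
    moreover have "N0 = free_module {0} \<inter> {u. aug0 u \<in> I}" by (auto simp: N0_def)
    ultimately show ?thesis by (simp add: M.subspace_inter[OF subspace_free_module])
  qed
  moreover have "free_homog_part (\<lambda>_. 0) j u \<in> N0" if "u \<in> N0" for u j
    using that free_homog_part_in[of u "{0}" "\<lambda>_. 0" j] free_part_subset[of "{0}" "\<lambda>_. 0" j]
    by (auto simp: N0_def aug0_def homog)
  ultimately have N0: "graded_submodule {0} (\<lambda>_. 0) N0"
    by (simp add: graded_submodule_def) (simp add: N0_def)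
  \<comment> \<open>A state of the construction is a free module, its differential, and the graded submodule \<open>N\<close>
    that the next free module has to cover. In position 0 this is the kernel of the augmentation
    to \<open>S/I\<close>, afterwards the kernel of the differential.\<close>
  define P where "P n x \<longleftrightarrow> (case x of (B, s, d, N) \<Rightarrow> graded_submodule B s N) \<and>
      (n = 0 \<longrightarrow> (\<exists>d. x = ({0}, \<lambda>_. 0, d, N0)))"
    for n :: nat and x :: "nat set \<times> (nat \<Rightarrow> int) \<times>
      ((nat \<Rightarrow>\<^sub>0 ('v, 'k) mpoly) \<Rightarrow> (nat \<Rightarrow>\<^sub>0 ('v, 'k) mpoly)) \<times> (nat \<Rightarrow>\<^sub>0 ('v, 'k) mpoly) set"
  define Q where "Q x y \<longleftrightarrow> (case (x, y) of ((B, s, d, N), (B', s', d', N')) \<Rightarrow>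
      module_hom scal scal d' \<and> (\<forall>j. d' ` free_part B' s' j \<subseteq> free_part B s j) \<and>
      d' ` free_module B' = N \<and> N' = {u \<in> free_module B'. d' u = 0})"
    for x y :: "nat set \<times> (nat \<Rightarrow> int) \<times>
      ((nat \<Rightarrow>\<^sub>0 ('v, 'k) mpoly) \<Rightarrow> (nat \<Rightarrow>\<^sub>0 ('v, 'k) mpoly)) \<times> (nat \<Rightarrow>\<^sub>0 ('v, 'k) mpoly) set"
  have "\<exists>f. \<forall>n. P n (f n) \<and> Q (f n) (f (Suc n))"
  proof (rule dependent_nat_choice[where P = P and Q = "\<lambda>_. Q"])
    show "\<exists>x. P 0 x" using N0 by (auto simp: P_def)
  next
    fix x n assume "P n x"
    obtain B s d N where x: "x = (B, s, d, N)" by (cases x)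
    then have gr: "graded_submodule B s N" using \<open>P n x\<close> by (simp add: P_def)
    obtain B' :: "nat set" and s' d'
      where d': "module_hom scal scal d'" "\<forall>j. d' ` free_part B' s' j \<subseteq> free_part B s j"
        "d' ` free_module B' = N"
      using graded_free_cover[OF gr] by metis
    let ?y = "(B', s', d', {u \<in> free_module B'. d' u = 0})"
    have "P (Suc n) ?y" using kernel_graded_submodule[OF d'(1) spec[OF d'(2)]] by (simp add: P_def)
    moreover have "Q x ?y" using d' by (simp add: Q_def x)
    ultimately show "\<exists>y. P (Suc n) y \<and> Q x y" by blast
  qed
  then obtain f where P: "\<And>n. P n (f n)" and Q: "\<And>n. Q (f n) (f (Suc n))" by blast
  define F :: "('v, 'k) graded_free_complex" where
    "F = \<lparr>basis = \<lambda>n. fst (f n), shift = \<lambda>n. fst (snd (f n)), diff = \<lambda>n. fst (snd (snd (f n))),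
      aug = aug0\<rparr>"
  define N where "N n = snd (snd (snd (f n)))" for n
  have base: "basis F 0 = {0}" "shift F 0 = (\<lambda>_. 0)" "N 0 = N0"
    using P[of 0] by (auto simp: P_def F_def N_def)
  have step: "module_hom scal scal (diff F (Suc n))"
    "diff F (Suc n) ` free_part (basis F (Suc n)) (shift F (Suc n)) j
      \<subseteq> free_part (basis F n) (shift F n) j"
    "diff F (Suc n) ` free_module (basis F (Suc n)) = N n"
    "N (Suc n) = {u \<in> free_module (basis F (Suc n)). diff F (Suc n) u = 0}" for n j
    using Q[of n] by (auto simp: Q_def F_def N_def split_beta)
  have aug_F: "aug F = aug0" by (simp add: F_def)
  have "graded_free_resolution F I"
    unfolding graded_free_resolution_def
  proof (intro conjI allI impI)
    fix i :: nat assume "i \<ge> 1"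
    then obtain n where i: "i = Suc n" by (cases i) auto
    show "module_hom scal scal (diff F i)" by (simp add: i step)
    show "diff F i ` free_part (basis F i) (shift F i) j
        \<subseteq> free_part (basis F (i - 1)) (shift F (i - 1)) j" for j
      using step(2) by (simp add: i)
    show "{u \<in> free_module (basis F i). diff F i u = 0}
        = diff F (Suc i) ` free_module (basis F (Suc i))"
      by (simp add: i step(3,4))
  next
    show "module_hom scal (*) (aug F)" by (simp add: aug_F aug0)
    show "aug F ` free_part (basis F 0) (shift F 0) j \<subseteq> homog j" for j
      by (auto simp: aug_F aug0_def base free_part_def)
    show "{u \<in> free_module (basis F 0). aug F u \<in> I} = diff F 1 ` free_module (basis F 1)"
      using step(3)[of 0] by (simp add: base aug_F N0_def)
    show "\<exists>u\<in>free_module (basis F 0). p - aug F u \<in> I" for p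
      by (rule bexI[of _ "monom 0 p"])
        (auto simp: aug_F aug0_def base free_module_def R.subspace_0[OF I])
  qed
  then show ?thesis ..
qed

text \<open>Multiplication by \<open>g\<close> is a homogeneous map from the free module of rank one with generator in
  degree \<open>i\<close>.\<close>

lemma homog_part_mult_homog:
  fixes r g :: "('v::finite, 'k::comm_ring_1) mpoly"
  assumes "g \<in> homog i"
  shows "homog_part j (r * g) = homog_part (j - i) r * g"
proof -
  have "homog_part j (coeff (monom (0::nat) r) 0 * g)
      = coeff (free_homog_part (\<lambda>_. i) j (monom (0::nat) r)) 0 * g"
  proof (rule homogeneous_map_commutes_part[where N=homog and B="{0}" and d="\<lambda>u. coeff u 0 * g"])
    show "additive (\<lambda>u :: nat \<Rightarrow>\<^sub>0 _. coeff u 0 * g)"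
      by (simp add: additive_def lookup_add distrib_right)
    fix k
    have "coeff u 0 * g \<in> homog k" if "u \<in> free_part {0::nat} (\<lambda>_. i) k" for u
      using that homog_mult[OF _ assms, of "coeff u 0" "k - i"] by (auto simp: free_part_def)
    then show "(\<lambda>u. coeff u 0 * g) ` free_part {0::nat} (\<lambda>_. i) k \<subseteq> homog k" by blast
  qed (auto simp: homog_part_add homog_part_homog free_module_def)
  then show ?thesis by simp
qed

lemma homog_part_ideal:
  fixes G :: "('v::finite, 'k::comm_ring_1) mpoly set"
  assumes G: "\<And>g. g \<in> G \<Longrightarrow> g \<in> homog i" and p: "p \<in> ideal_generated G"
  shows "homog_part j p \<in> ideal_generated G"
proof -
  interpret R: module "(*) :: ('v, 'k) mpoly \<Rightarrow> _" by (rule module_times)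
  show ?thesis using p unfolding ideal_generated_def
  proof (induction rule: R.span_induct_alt)
    case base
    show ?case by (simp add: R.span_zero)
  next
    case (step c x y)
    then show ?case
      by (simp add: homog_part_add homog_part_mult_homog[OF G] R.span_add R.span_scale R.span_base)
  qed
qed

section \<open>Tor in terms of a resolution\<close>

text \<open>A basis of \<open>B\<close> extends to a basis of \<open>Z\<close>, and the added vectors represent a basis of the
  quotient. This shows that the chosen quotient basis really is one; it cannot be empty, since
  otherwise \<open>B\<close> would be all of \<open>Z\<close>.\<close>

lemma quotient_dim_pos:
  assumes Z: "module.subspace scal Z" and B: "module.subspace scal B" and "B \<subset> Z"
  shows "quotient_dim Z (B :: ('b \<Rightarrow>\<^sub>0 'k::field) set) > 0"
proof -
  interpret V: vector_space "scal :: 'k \<Rightarrow> ('b \<Rightarrow>\<^sub>0 'k) \<Rightarrow> _" by (rule vector_space_scal)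
  obtain A where A: "A \<subseteq> B" "V.independent A" "B \<subseteq> V.span A"
    using V.maximal_independent_subset by blast
  then have span_A: "V.span A = B" using V.span_subspace B by blast
  obtain A' where A': "A \<subseteq> A'" "A' \<subseteq> Z" "V.independent A'" "Z \<subseteq> V.span A'"
    using V.maximal_independent_subset_extend[of A Z] A \<open>B \<subset> Z\<close> by blast
  then have span_A': "V.span A' = Z" using V.span_subspace Z by blast
  have "v = 0" if "v \<in> V.span (A' - A)" "v \<in> B" for v
  proof -
    have "V.representation A' v = V.representation (A' - A) v"
      "V.representation A' v = V.representation A v"
      using A' that by (auto intro!: V.representation_extend simp: span_A)
    then have "V.representation A' v b = 0" for b
      using V.representation_ne_zero[of "A' - A" v b] V.representation_ne_zero[of A v b] by auto
    moreover have "v \<in> V.span A'" using that \<open>B \<subset> Z\<close> span_A' by auto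
    ultimately show ?thesis
      using V.sum_nonzero_representation_eq[OF A'(3), of v] by simp
  qed
  then have "V.span (A' - A) \<inter> B = {0}" using V.span_zero V.subspace_0[OF B] by blast
  moreover have "V.span ((A' - A) \<union> B) = Z"
  proof
    show "V.span ((A' - A) \<union> B) \<subseteq> Z"
      using A' \<open>B \<subset> Z\<close> by (intro V.span_minimal Z) auto
    show "Z \<subseteq> V.span ((A' - A) \<union> B)"
      unfolding span_A'[symmetric] using A by (intro V.span_mono) auto
  qed
  moreover have "V.independent (A' - A)" using A'(3) by (rule V.independent_mono) auto
  ultimately have "\<exists>C. quotient_basis Z B C" unfolding quotient_basis_def by blast
  then have "quotient_basis Z B (SOME C. quotient_basis Z B C)" by (rule someI_ex)
  moreover have "C \<noteq> {}" if "quotient_basis Z B C" for C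
  proof
    assume "C = {}"
    then have "V.span B = Z" using that by (simp add: quotient_basis_def)
    moreover have "V.span B = B" using B by (rule V.span_eq_iff[THEN iffD2])
    ultimately show False using \<open>B \<subset> Z\<close> by blast
  qed
  ultimately have "(SOME C. quotient_basis Z B C) \<noteq> {}" by blast
  then show ?thesis
    by (simp add: quotient_dim_def Let_def card_gt_0_iff zero_enat_def)
qed

lemma coeff_map_const_term [simp]:
  "coeff (Poly_Mapping.map const_term u) b = const_term (coeff u b)"
  by (simp add: Poly_Mapping.map.rep_eq when_def const_term_def)

lemma coeff_map_const_mpoly [simp]:
  "coeff (Poly_Mapping.map const_mpoly a) b = const_mpoly (coeff a b)"
  by (simp add: Poly_Mapping.map.rep_eq when_def const_mpoly_def)

lemma const_term_const_mpoly [simp]: "const_term (const_mpoly c) = c"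
  by (simp add: const_term_def const_mpoly_def)

lemma const_term_add: "const_term (p + q) = const_term p + const_term q"
  and const_term_diff: "const_term (p - q) = const_term p - const_term q"
  and const_term_0 [simp]: "const_term 0 = 0"
  for p q :: "('v, 'k::field) mpoly"
  by (simp_all add: const_term_def lookup_add lookup_minus)

text \<open>A linear map sends the maximal ideal times the source into the maximal ideal times the target.\<close>

lemma const_term_hom_zero:
  fixes d :: "('b \<Rightarrow>\<^sub>0 ('v::finite, 'k::field) mpoly) \<Rightarrow> ('c \<Rightarrow>\<^sub>0 ('v, 'k) mpoly)"
  assumes d: "module_hom scal scal d" and r: "\<And>b. const_term (coeff r b) = 0"
  shows "Poly_Mapping.map const_term (d r) = 0"
proof (rule poly_mapping_eqI)
  fix c
  have "const_term (\<Sum>b\<in>A. coeff r b * h b) = 0" for h :: "'b \<Rightarrow> ('v, 'k) mpoly" and A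
    by (induction A rule: infinite_finite_induct) (simp_all add: const_term_add const_term_mult r)
  then show "coeff (Poly_Mapping.map const_term (d r)) c = coeff 0 c"
    by (subst hom_eq_lin_ext[OF d]) (simp add: lin_ext_def lookup_sum)
qed

context
  fixes F :: "('v::finite, 'k::field) graded_free_complex" and I :: "('v, 'k) mpoly set"
  assumes res: "graded_free_resolution F I"
begin

lemma resolution_hom: "module_hom scal scal (diff F (Suc i))"
  using res by (simp add: graded_free_resolution_def)

lemma resolution_degree:
  "diff F (Suc i) ` free_part (basis F (Suc i)) (shift F (Suc i)) j
     \<subseteq> free_part (basis F i) (shift F i) j"
proof -
  have "\<forall>i\<ge>1. module_hom scal scal (diff F i) \<and>
      (\<forall>j. diff F i ` free_part (basis F i) (shift F i) j
         \<subseteq> free_part (basis F (i - 1)) (shift F (i - 1)) j)"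
    using res unfolding graded_free_resolution_def by (rule conjunct1)
  from this[rule_format, of "Suc i"] show ?thesis by simp
qed

lemma resolution_exact:
  assumes "u \<in> free_module (basis F (Suc i))"
  shows "diff F (Suc i) u = 0 \<longleftrightarrow> u \<in> diff F (Suc (Suc i)) ` free_module (basis F (Suc (Suc i)))"
proof -
  have "Suc i \<ge> 1 \<longrightarrow> {u \<in> free_module (basis F (Suc i)). diff F (Suc i) u = 0}
      = diff F (Suc (Suc i)) ` free_module (basis F (Suc (Suc i)))"
    using res unfolding graded_free_resolution_def by blast
  then show ?thesis using assms by auto
qed

lemma homogeneous_preimage:
  assumes y: "y \<in> free_part (basis F i) (shift F i) j"
    and im: "y \<in> diff F (Suc i) ` free_module (basis F (Suc i))"
  obtains x where "x \<in> free_part (basis F (Suc i)) (shift F (Suc i)) j" "diff F (Suc i) x = y"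
proof -
  interpret d: module_hom scal scal "diff F (Suc i)" by (rule resolution_hom)
  obtain x where x: "x \<in> free_module (basis F (Suc i))" "y = diff F (Suc i) x" using im by blast
  have "free_homog_part (shift F i) j (diff F (Suc i) x)
      = diff F (Suc i) (free_homog_part (shift F (Suc i)) j x)"
  proof (rule homogeneous_map_commutes_part[where N = "free_part (basis F i) (shift F i)"])
    show "additive (diff F (Suc i))" by (simp add: additive_def d.add)
  qed (fact free_homog_part_add free_homog_part_free_part resolution_degree x(1))+
  then have "diff F (Suc i) (free_homog_part (shift F (Suc i)) j x) = y"
    using free_homog_part_free_part[OF y] by (simp add: x(2))
  then show ?thesis using that free_homog_part_in[OF x(1)] by blast
qed

text \<open>The differential of the tensor product with \<open>K\<close> is defined on constant representatives; it
  may be computed on any other representative, because the difference has coefficients in the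
  maximal ideal.\<close>

lemma tensor_diff_const_term:
  "tensor_diff F (Suc i) (Poly_Mapping.map const_term u)
     = Poly_Mapping.map const_term (diff F (Suc i) u)"
proof -
  interpret d: module_hom scal scal "diff F (Suc i)" by (rule resolution_hom)
  let ?u = "Poly_Mapping.map const_mpoly (Poly_Mapping.map const_term u)"
  have "Poly_Mapping.map const_term (diff F (Suc i) (u - ?u)) = 0"
    by (rule const_term_hom_zero[OF resolution_hom]) (simp add: lookup_minus const_term_diff)
  then have "coeff (Poly_Mapping.map const_term (diff F (Suc i) (u - ?u))) b = 0" for b
    by simp
  then have "const_term (coeff (diff F (Suc i) u) b) = const_term (coeff (diff F (Suc i) ?u) b)" for b
    by (simp add: d.diff lookup_minus const_term_diff)
  then show ?thesis
    unfolding tensor_diff_def by (intro poly_mapping_eqI) simp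
qed

text \<open>In degree \<open>j\<close> a coefficient can have a nonzero constant term only at a basis element that sits
  in degree \<open>j\<close> itself.\<close>

lemma const_term_tensor_part:
  fixes u :: "nat \<Rightarrow>\<^sub>0 ('v, 'k) mpoly"
  assumes "u \<in> free_part (basis F i) (shift F i) j"
  shows "Poly_Mapping.map const_term u \<in> tensor_part F i j"
proof -
  have "b \<in> basis F i \<and> shift F i b = j" if "const_term (coeff u b) \<noteq> 0" for b
  proof -
    have "coeff u b \<noteq> 0" using that by auto
    then have "b \<in> basis F i"
      using assms by (auto simp: free_part_def free_module_def in_keys_iff)
    moreover have "coeff u b \<in> homog (j - shift F i b)" using assms by (simp add: free_part_def)
    then have "int (mdeg (0 :: 'v \<Rightarrow>\<^sub>0 nat)) = j - shift F i b"
      using that homog_iff[THEN iffD1, rule_format, of "coeff u b" "j - shift F i b" 0]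
      by (simp add: const_term_def)
    ultimately show ?thesis by (simp add: mdeg_def)
  qed
  then show ?thesis
    by (auto simp: tensor_part_def free_module_def in_keys_iff)
qed

lemma const_mpoly_free_part:
  assumes "a \<in> tensor_part F i j"
  shows "(Poly_Mapping.map const_mpoly a :: nat \<Rightarrow>\<^sub>0 ('v, 'k) mpoly)
    \<in> free_part (basis F i) (shift F i) j"
proof -
  have a: "b \<in> basis F i \<and> shift F i b = j" if "coeff a b \<noteq> 0" for b
    using assms that by (auto simp: tensor_part_def free_module_def in_keys_iff)
  have "const_mpoly (coeff a b) \<in> (homog (j - shift F i b) :: ('v, 'k) mpoly set)" for b
    using a[of b] by (auto simp: homog_iff const_mpoly_def lookup_single when_def mdeg_def)
  moreover have "b \<in> basis F i" if "const_mpoly (coeff a b) \<noteq> (0 :: ('v, 'k) mpoly)" for b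
    using a[of b] that by (cases "coeff a b = 0") (simp_all add: const_mpoly_def)
  ultimately show ?thesis
    by (auto simp: free_part_def free_module_def in_keys_iff)
qed

lemma tensor_diff_hom: "module_hom scal scal (tensor_diff F (Suc i))"
proof -
  interpret d: module_hom scal scal "diff F (Suc i)" by (rule resolution_hom)
  have const_add: "Poly_Mapping.map const_mpoly (a + b)
      = (Poly_Mapping.map const_mpoly a + Poly_Mapping.map const_mpoly b :: nat \<Rightarrow>\<^sub>0 ('v, 'k) mpoly)" for a b
    by (rule poly_mapping_eqI) (simp add: lookup_add const_mpoly_def single_add)
  have const_scal: "Poly_Mapping.map const_mpoly (scal c a)
      = (scal (const_mpoly c) (Poly_Mapping.map const_mpoly a) :: nat \<Rightarrow>\<^sub>0 ('v, 'k) mpoly)" for c a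
    by (rule poly_mapping_eqI) (simp add: const_mpoly_def mult_single)
  interpret V: module "scal :: 'k \<Rightarrow> (nat \<Rightarrow>\<^sub>0 'k) \<Rightarrow> _" by (rule module_scal)
  show ?thesis
    by unfold_locales
      (auto intro!: poly_mapping_eqI simp: tensor_diff_def const_add const_scal d.add d.scale
        lookup_add const_term_add const_term_mult)
qed

lemma subspace_tor_cycles: "module.subspace scal (tor_cycles F (Suc i) j)"
proof -
  interpret t: module_hom scal scal "tensor_diff F (Suc i)" by (rule tensor_diff_hom)
  have "tor_cycles F (Suc i) j = tensor_part F (Suc i) j \<inter> {a. tensor_diff F (Suc i) a = 0}"
    by (auto simp: tor_cycles_def)
  then show ?thesis unfolding tensor_part_def
    by (simp add: t.m1.subspace_inter[OF subspace_free_module t.subspace_kernel])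
qed

lemma subspace_tor_boundaries: "module.subspace scal (tor_boundaries F i j)"
  unfolding tor_boundaries_def tensor_part_def
  by (rule module_hom.subspace_image[OF tensor_diff_hom subspace_free_module])

lemma tor_boundaries_subset_cycles: "tor_boundaries F (Suc i) j \<subseteq> tor_cycles F (Suc i) j"
proof
  fix a assume "a \<in> tor_boundaries F (Suc i) j"
  then obtain c where c: "c \<in> tensor_part F (Suc (Suc i)) j" and a: "a = tensor_diff F (Suc (Suc i)) c"
    by (auto simp: tor_boundaries_def)
  define v where "v = diff F (Suc (Suc i)) (Poly_Mapping.map const_mpoly c)"
  have v: "v \<in> free_part (basis F (Suc i)) (shift F (Suc i)) j"
    unfolding v_def using resolution_degree const_mpoly_free_part[OF c] by blast
  have a_v: "a = Poly_Mapping.map const_term v" by (simp add: a v_def tensor_diff_def)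
  have "diff F (Suc i) v = 0"
    using resolution_exact[of v i] v const_mpoly_free_part[OF c] free_part_subset
    unfolding v_def by blast
  then have "tensor_diff F (Suc i) a = 0"
    by (simp add: a_v tensor_diff_const_term) (simp add: poly_mapping_eq_iff fun_eq_iff)
  then show "a \<in> tor_cycles F (Suc i) j"
    using const_term_tensor_part[OF v] by (simp add: tor_cycles_def a_v)
qed

text \<open>If Tor vanishes, the class of \<open>u\<close> modulo the maximal ideal is a boundary, and subtracting a lift
  of this boundary from \<open>u\<close> leaves the image under the differential unchanged. Hence a syzygy of
  degree \<open>j\<close> with coefficients in the maximal ideal is a combination of syzygies with coefficients in
  the maximal ideal.\<close>

lemma tor_zero_lift:
  assumes tor: "tor_cycles F (Suc i) j \<subseteq> tor_boundaries F (Suc i) j"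
    and u: "u \<in> free_part (basis F (Suc i)) (shift F (Suc i)) j"
    and du: "Poly_Mapping.map const_term (diff F (Suc i) u) = 0"
  obtains u' where "u' \<in> free_module (basis F (Suc i))" "diff F (Suc i) u' = diff F (Suc i) u"
    "\<And>b. const_term (coeff u' b) = 0"
proof -
  interpret d: module_hom scal scal "diff F (Suc i)" by (rule resolution_hom)
  have "Poly_Mapping.map const_term u \<in> tor_cycles F (Suc i) j"
    using const_term_tensor_part[OF u] du by (simp add: tor_cycles_def tensor_diff_const_term)
  then obtain c where c: "c \<in> tensor_part F (Suc (Suc i)) j"
    "Poly_Mapping.map const_term u = tensor_diff F (Suc (Suc i)) c"
    using tor by (auto simp: tor_boundaries_def)
  define v where "v = diff F (Suc (Suc i)) (Poly_Mapping.map const_mpoly c)"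
  have v: "v \<in> free_module (basis F (Suc i))"
    unfolding v_def using resolution_degree const_mpoly_free_part[OF c(1)] free_part_subset by blast
  have "diff F (Suc i) v = 0"
    using resolution_exact[OF v] const_mpoly_free_part[OF c(1)] free_part_subset
    unfolding v_def by blast
  then have "diff F (Suc i) (u - v) = diff F (Suc i) u" by (simp add: d.diff)
  moreover have "const_term (coeff (u - v) b) = 0" for b
  proof -
    have "coeff (Poly_Mapping.map const_term u) b = coeff (Poly_Mapping.map const_term v) b"
      by (simp add: c(2) tensor_diff_def v_def del: coeff_map_const_term)
    then show ?thesis by (simp add: lookup_minus const_term_diff)
  qed
  moreover have "u - v \<in> free_module (basis F (Suc i))"
    using d.m1.subspace_diff[OF subspace_free_module] u v free_part_subset by blast
  ultimately show ?thesis using that by blast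
qed

end

section \<open>The binomials of the diamond lattice\<close>

abbreviation pair_monom :: "'n \<Rightarrow> 'n \<Rightarrow> ('n diamond \<Rightarrow>\<^sub>0 nat)" where
  "pair_monom i j \<equiv> monom (DY i) 1 + monom (DY j) 1"

abbreviation xz_monom :: "'n diamond \<Rightarrow>\<^sub>0 nat" where
  "xz_monom \<equiv> monom DX 1 + monom DZ 1"

definition diamond_binomial :: "'n \<Rightarrow> 'n \<Rightarrow> ('n diamond, 'k::field) mpoly" where
  "diamond_binomial i j = Var (DY i) * Var (DY j) - Var DX * Var DZ"

lemma diamond_binomial_monom: "diamond_binomial i j = monom (pair_monom i j) 1 - monom xz_monom 1"
  by (simp add: diamond_binomial_def Var_def mult_single)

lemma diamond_binomial_homog: "diamond_binomial i j \<in> homog 2"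
  for i j :: "'n::finite"
proof -
  have "mdeg (monom (v :: 'n diamond) 1) = 1" for v by (simp add: mdeg_def)
  then show ?thesis
    by (auto simp: diamond_binomial_monom homog_iff lookup_minus lookup_single when_def mdeg_add
        split: if_splits)
qed

lemma xz_monom_divisor:
  assumes "m + m' = xz_monom" "m \<noteq> 0"
  shows "m' \<in> {0, monom DX 1, monom DZ (1::nat)}"
proof -
  have sum: "coeff m v + coeff m' v = coeff xz_monom v" for v
    by (metis assms(1) lookup_add)
  have y: "coeff m (DY i) = 0" "coeff m' (DY i) = 0" for i
    using sum[of "DY i"] by (simp_all add: lookup_add lookup_single)
  have x: "coeff m DX + coeff m' DX = 1" and z: "coeff m DZ + coeff m' DZ = 1"
    using sum[of DX] sum[of DZ] by (simp_all add: lookup_add lookup_single)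
  have "coeff m DX \<noteq> 0 \<or> coeff m DZ \<noteq> 0"
  proof (rule ccontr)
    assume "\<not> ?thesis"
    then have "coeff m v = 0" for v using y by (cases v) auto
    then show False using assms(2) by (simp add: poly_mapping_eq_iff fun_eq_iff)
  qed
  then consider "coeff m' DX = 0" "coeff m' DZ = 0" | "coeff m' DX = 1" "coeff m' DZ = 0"
    | "coeff m' DX = 0" "coeff m' DZ = 1"
    using x z by linarith
  then show ?thesis
  proof cases
    case 1
    then have "coeff m' v = 0" for v using y by (cases v) auto
    then have "m' = 0" by (intro poly_mapping_eqI) simp
    then show ?thesis by simp
  next
    case 2
    then have "coeff m' v = coeff (monom DX 1) v" for v
      using y by (cases v) (auto simp: lookup_single)
    then have "m' = monom DX 1" by (rule poly_mapping_eqI)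
    then show ?thesis by simp
  next
    case 3
    then have "coeff m' v = coeff (monom DZ 1) v" for v
      using y by (cases v) (auto simp: lookup_single)
    then have "m' = monom DZ 1" by (rule poly_mapping_eqI)
    then show ?thesis by simp
  qed
qed

lemma coeff_binomial_mult_xz:
  "coeff (diamond_binomial i j * p) xz_monom = - const_term p"
proof -
  have "xz_monom \<noteq> pair_monom i j + m" for m
  proof
    assume "xz_monom = pair_monom i j + m"
    then have "coeff xz_monom (DY i) = coeff (pair_monom i j + m) (DY i)" by simp
    then show False by (simp add: lookup_add lookup_single)
  qed
  then have "coeff (monom (pair_monom i j) 1 * p) xz_monom = 0"
    by (rule coeff_monom_mult_other)
  moreover have "coeff (monom xz_monom 1 * p) xz_monom = coeff p 0"
    using coeff_monom_mult_add[of xz_monom 1 p 0] by simp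
  ultimately show ?thesis
    by (simp add: diamond_binomial_monom left_diff_distrib lookup_minus const_term_def)
qed

lemma coeff_binomial_mult_pair:
  assumes "i \<noteq> j" and e: "e \<in> {0, monom DX 1, monom DZ 1}"
  shows "coeff (diamond_binomial a b * p) (pair_monom i j + e)
    = (if {a, b} = {i, j} then coeff p e else 0)"
proof -
  have "pair_monom i j + e \<noteq> xz_monom + m" for m
  proof
    assume eq: "pair_monom i j + e = xz_monom + m"
    have "coeff (pair_monom i j + e) v = coeff (xz_monom + m) v" for v by (simp only: eq)
    from this[of DX] this[of DZ] show False
      using e by (auto simp: lookup_add lookup_single)
  qed
  then have xz: "coeff (monom xz_monom 1 * p) (pair_monom i j + e) = 0"
    by (rule coeff_monom_mult_other)
  have "coeff (monom (pair_monom a b) 1 * p) (pair_monom i j + e)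
    = (if {a, b} = {i, j} then coeff p e else 0)"
  proof (cases "{a, b} = {i, j}")
    case True
    then have "pair_monom i j = pair_monom a b"
      by (auto simp: doubleton_eq_iff add.commute)
    then show ?thesis using True coeff_monom_mult_add[of "pair_monom a b" 1 p e] by simp
  next
    case False
    have "pair_monom i j + e \<noteq> pair_monom a b + m" for m
    proof
      assume eq: "pair_monom i j + e = pair_monom a b + m"
      have "coeff (pair_monom i j + e) v = coeff (pair_monom a b + m) v" for v by (simp only: eq)
      from this[of "DY a"] this[of "DY b"] show False
        using e False assms(1)
        by (auto simp: lookup_add lookup_single when_def split: if_splits)
    qed
    then show ?thesis using False by (simp add: coeff_monom_mult_other)
  qed
  then show ?thesis using xz
    by (simp add: diamond_binomial_monom left_diff_distrib lookup_minus)
qed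

text \<open>The elements of the ideal have no monomial \<open>y\<^sub>iy\<^sub>je\<close>, since it is divisible neither by \<open>xz\<close> nor by
  \<open>y\<^sub>ay\<^sub>b\<close> for another pair, squares included; whereas the coefficient of this monomial in the
  product of \<open>f\<^sub>i\<^sub>j\<close> and \<open>p\<close> is the coefficient of \<open>e\<close> in \<open>p\<close>.\<close>

lemma other_binomials_colon:
  fixes p :: "('n diamond, 'k::field) mpoly"
  assumes "i \<noteq> j" and e: "e \<in> {0, monom DX 1, monom DZ 1}"
    and p: "diamond_binomial i j * p \<in> ideal_generated {diamond_binomial a b | a b. {a, b} \<noteq> {i, j}}"
  shows "coeff p e = 0"
proof -
  interpret R: module "(*) :: ('n diamond, 'k) mpoly \<Rightarrow> _" by (rule module_times)
  have "coeff h (pair_monom i j + e) = 0"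
    if "h \<in> ideal_generated {diamond_binomial a b | a b. {a, b} \<noteq> {i, j}}"
    for h :: "('n diamond, 'k) mpoly"
    using that unfolding ideal_generated_def
  proof (induction rule: R.span_induct_alt)
    case base
    show ?case by simp
  next
    case (step c x y)
    then obtain a b where "x = diamond_binomial a b" "{a, b} \<noteq> {i, j}" by blast
    then have "coeff (c * x) (pair_monom i j + e) = 0"
      using coeff_binomial_mult_pair[OF assms(1) e, of a b c] by (simp add: mult.commute)
    then show ?case using step by (simp add: lookup_add)
  qed
  from this[OF p] show ?thesis
    using coeff_binomial_mult_pair[OF assms(1) e, of i j p] by simp
qed

lemma const_term_Var [simp]: "const_term (Var v) = (0 :: 'k::field)"
proof -
  have "monom v (1::nat) \<noteq> 0" by (metis lookup_single_eq lookup_zero one_neq_zero)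
  then show ?thesis by (simp add: const_term_def Var_def lookup_single)
qed

lemma ideal_const_term_zero:
  fixes G :: "('v::finite, 'k::field) mpoly set"
  assumes G: "\<And>g. g \<in> G \<Longrightarrow> const_term g = 0" and "p \<in> ideal_generated G"
  shows "const_term p = 0"
proof -
  interpret R: module "(*) :: ('v, 'k) mpoly \<Rightarrow> _" by (rule module_times)
  show ?thesis using assms(2) unfolding ideal_generated_def
    by (induction rule: R.span_induct_alt) (simp_all add: const_term_add const_term_mult G)
qed

section \<open>A Koszul syzygy that is not generated in lower degree\<close>

text \<open>The Koszul syzygy between \<open>f = f\<^sub>i\<^sub>j\<close> and \<open>f' = f\<^sub>i\<^sub>k\<close> is followed through the resolution. The
  functional \<open>\<psi>\<close> is determined only up to the colon ideal of \<open>J\<close> by \<open>f\<close>, where \<open>J\<close> is generated by the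
  binomials \<open>f\<^sub>a\<^sub>b\<close> other than \<open>f\<close>; the elements of this colon ideal have vanishing coefficients at \<open>1\<close>, \<open>x\<close> and \<open>z\<close>,
  but not necessarily at \<open>xz\<close>. Therefore \<open>\<psi>\<close> has to be fixed on a basis and extended linearly: the
  ambiguity then enters \<open>\<psi> t\<close> only multiplied by coefficients without constant term.\<close>

lemma diamond_tor_nonzero:
  fixes F :: "('n::finite diamond, 'k::field) graded_free_complex"
  assumes res: "graded_free_resolution F (ideal_generated {diamond_binomial i j | i j. i \<noteq> j})"
    (is "graded_free_resolution F ?I")
    and ijk: "i \<noteq> j" "i \<noteq> k" "j \<noteq> (k::'n)"
  shows "\<not> tor_cycles F 2 4 \<subseteq> tor_boundaries F 2 4"
proof
  \<comment> \<open>keeps the homological degrees in the form 1 and 2\<close>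
  note One_nat_def [simp del] One_nat_def [symmetric, simp] Suc_1 [simp]
  assume "tor_cycles F 2 4 \<subseteq> tor_boundaries F 2 4"
  then have tor: "tor_cycles F (Suc 1) 4 \<subseteq> tor_boundaries F (Suc 1) 4"
    by simp
  interpret R: module "(*) :: ('n diamond, 'k) mpoly \<Rightarrow> _" by (rule module_times)
  interpret M: module "scal :: _ \<Rightarrow> (nat \<Rightarrow>\<^sub>0 ('n diamond, 'k) mpoly) \<Rightarrow> _" by (rule module_scal)
  define f :: "('n diamond, 'k) mpoly" where "f = diamond_binomial i j"
  define f' :: "('n diamond, 'k) mpoly" where "f' = diamond_binomial i k"
  define J :: "('n diamond, 'k) mpoly set" where
    "J = ideal_generated {diamond_binomial a b | a b. {a, b} \<noteq> {i, j}}"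
  have subJ: "R.subspace J" by (simp add: J_def ideal_generated_def)
  have f'J: "f' \<in> J"
    unfolding J_def ideal_generated_def f'_def using ijk
    by (intro R.span_base) (auto simp: doubleton_eq_iff)
  have ff'I: "f \<in> ?I" "f' \<in> ?I"
    unfolding ideal_generated_def f_def f'_def using ijk by (auto intro!: R.span_base)
  have subI: "R.subspace ?I" by (simp add: ideal_generated_def)
  have I_J: "\<exists>c. h - c * f \<in> J" if "h \<in> ?I" for h
  proof -
    have sub: "{diamond_binomial a b | a b. a \<noteq> b} \<subseteq>
        insert f {diamond_binomial a b | a b. {a, b} \<noteq> {i, j}}"
    proof
      fix g :: "('n diamond, 'k) mpoly" assume "g \<in> {diamond_binomial a b | a b. a \<noteq> b}"
      then obtain a b where g: "g = diamond_binomial a b" by blast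
      show "g \<in> insert f {diamond_binomial a b | a b. {a, b} \<noteq> {i, j}}"
      proof (cases "{a, b} = {i, j}")
        case True
        then have "g = f" by (auto simp: g f_def diamond_binomial_def doubleton_eq_iff mult.commute)
        then show ?thesis by simp
      next
        case False
        then show ?thesis using g by blast
      qed
    qed
    then show ?thesis
      using that R.span_mono[OF sub] unfolding J_def ideal_generated_def R.span_breakdown_eq[symmetric]
      by blast
  qed
  have I0: "const_term h = 0" if "h \<in> ?I" for h
    using that
  proof (rule ideal_const_term_zero[rotated])
    fix g :: "('n diamond, 'k) mpoly" assume "g \<in> {diamond_binomial i j | i j. i \<noteq> j}"
    then show "const_term g = 0"
      by (auto simp: diamond_binomial_def const_term_diff const_term_mult)
  qed
  have homog_f: "f \<in> homog 2" "f' \<in> homog 2"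
    by (simp_all add: f_def f'_def diamond_binomial_homog)
  have aug: "module_hom scal (*) (aug F)"
    "\<And>j. aug F ` free_part (basis F 0) (shift F 0) j \<subseteq> homog j"
    "{u \<in> free_module (basis F 0). aug F u \<in> ?I} = diff F 1 ` free_module (basis F 1)"
    "\<exists>u \<in> free_module (basis F 0). 1 - aug F u \<in> ?I"
    using res unfolding graded_free_resolution_def by simp_all
  interpret a: module_hom scal "(*)" "aug F" by (rule aug(1))
  interpret d1: module_hom scal scal "diff F 1" using resolution_hom[OF res, of 0] by simp
  \<comment> \<open>\<open>a\<close> represents \<open>1\<close> in \<open>F\<^sub>0\<close>; of its image only the constant term will matter.\<close>
  obtain a where a: "a \<in> free_part (basis F 0) (shift F 0) 0" "const_term (aug F a) = 1"
  proof -
    obtain u where u: "u \<in> free_module (basis F 0)" "1 - aug F u \<in> ?I" using aug(4) by blast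
    have "homog_part 0 (aug F u) = aug F (free_homog_part (shift F 0) 0 u)"
    proof (rule homogeneous_map_commutes_part[where N = homog])
      show "additive (aug F)" by (simp add: additive_def a.add)
    qed (fact homog_part_add homog_part_homog aug(2) u(1))+
    then have "const_term (aug F (free_homog_part (shift F 0) 0 u)) = const_term (aug F u)"
      by (simp add: const_term_def mdeg_def flip: \<open>_ = aug F (free_homog_part _ _ _)\<close>)
    also have "\<dots> = 1"
      using I0[OF u(2)] by (simp add: const_term_diff) (simp add: const_term_def)
    finally show ?thesis using that free_homog_part_in[OF u(1)] by blast
  qed
  have lift: "\<exists>w. w \<in> free_part (basis F 1) (shift F 1) 2 \<and> diff F 1 w = scal g a"
    if g: "g \<in> ?I" "g \<in> homog 2" for g
  proof -
    have ga: "scal g a \<in> free_part (basis F 0) (shift F 0) 2"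
      using free_part_scal[OF g(2) a(1)] by simp
    have "aug F (scal g a) \<in> ?I"
      using R.subspace_scale[OF subI g(1), of "aug F a"] by (simp add: a.scale mult.commute)
    then have "scal g a \<in> diff F 1 ` free_module (basis F 1)"
      unfolding aug(3)[symmetric] using ga free_part_subset by blast
    then show ?thesis using homogeneous_preimage[OF res ga] by (metis One_nat_def)
  qed
  obtain w where w: "w \<in> free_part (basis F 1) (shift F 1) 2" "diff F 1 w = scal f a"
    using lift[OF ff'I(1) homog_f(1)] by blast
  obtain w' where w': "w' \<in> free_part (basis F 1) (shift F 1) 2" "diff F 1 w' = scal f' a"
    using lift[OF ff'I(2) homog_f(2)] by blast
  \<comment> \<open>the Koszul syzygy\<close>
  define t where "t = scal f' w - scal f w'"
  have t: "t \<in> free_part (basis F 1) (shift F 1) 4"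
  proof -
    have "- f \<in> homog 2" using homog_f(1) by (auto simp: homog_iff)
    from free_part_add[OF free_part_scal[OF homog_f(2) w(1)] free_part_scal[OF this w'(1)]]
    show ?thesis by (simp add: t_def M.scale_minus_left)
  qed
  have "diff F 1 t = 0"
    by (simp add: t_def d1.diff d1.scale w w' mult.commute)
  then have "t \<in> diff F 2 ` free_module (basis F 2)"
    using resolution_exact[OF res, of t 0] subsetD[OF free_part_subset t] by simp
  then obtain u where u: "u \<in> free_part (basis F 2) (shift F 2) 4" "diff F 2 u = t"
    using homogeneous_preimage[OF res, of t 1 4] t by auto
  have "Poly_Mapping.map const_term (diff F (Suc 1) u) = 0"
    using u(2) I0[OF ff'I(1)] I0[OF ff'I(2)]
    by (auto intro!: poly_mapping_eqI simp: t_def lookup_minus const_term_diff const_term_mult)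
  then obtain u' where u': "u' \<in> free_module (basis F 2)" "diff F 2 u' = t"
    "\<And>b. const_term (coeff u' b) = 0"
    using tor_zero_lift[OF res tor, of u] u by auto
  \<comment> \<open>For each basis element of \<open>F\<^sub>1\<close>, \<open>c\<close> selects the coefficient of \<open>f\<close> in one expression of
    its image in \<open>I\<close> by the generators.\<close>
  have "\<forall>b. \<exists>c. b \<in> basis F 1 \<longrightarrow> aug F (diff F 1 (monom b 1)) - c * f \<in> J"
  proof (intro allI)
    fix b
    show "\<exists>c. b \<in> basis F 1 \<longrightarrow> aug F (diff F 1 (monom b 1)) - c * f \<in> J"
    proof (cases "b \<in> basis F 1")
      case True
      then have "monom b 1 \<in> free_module (basis F 1)" by (simp add: free_module_def)
      then have "aug F (diff F 1 (monom b 1)) \<in> ?I" using aug(3) by blast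
      then show ?thesis using I_J by blast
    qed simp
  qed
  then obtain c where c: "\<And>b. b \<in> basis F 1 \<Longrightarrow> aug F (diff F 1 (monom b 1)) - c b * f \<in> J"
    by metis
  define \<psi> where "\<psi> = lin_ext (*) c"
  interpret \<psi>: module_hom scal "(*)" \<psi> unfolding \<psi>_def by (rule lin_ext_hom[OF module_times])
  have \<psi>: "aug F (diff F 1 v) - \<psi> v * f \<in> J" if v: "v \<in> free_module (basis F 1)" for v
  proof -
    have "module_hom scal (*) (\<lambda>v. aug F (diff F 1 v))"
      using module_hom_compose[OF d1.module_hom_axioms aug(1)] by (simp add: o_def)
    from hom_eq_lin_ext[OF this, of v] have eq: "aug F (diff F 1 v)
        = (\<Sum>b\<in>Poly_Mapping.keys v. coeff v b * aug F (diff F 1 (monom b 1)))"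
      unfolding lin_ext_def .
    have "aug F (diff F 1 v) - \<psi> v * f
        = (\<Sum>b\<in>Poly_Mapping.keys v. coeff v b * (aug F (diff F 1 (monom b 1)) - c b * f))"
      \<comment> \<open>\<open>scale_scale\<close> for the ring acting on itself is \<open>mult.assoc\<close> reversed\<close>
      unfolding eq \<psi>_def lin_ext_def
      by (simp add: sum_distrib_right sum_subtractf right_diff_distrib mult.assoc
          del: R.scale_scale)
    also have "\<dots> \<in> J"
      using v c by (intro R.subspace_sum[OF subJ] R.subspace_scale[OF subJ]) (auto simp: free_module_def)
    finally show ?thesis .
  qed
  have colon: "coeff p e = 0" if "f * p \<in> J" "e \<in> {0, monom DX 1, monom DZ 1}" for p e
    using other_binomials_colon[OF ijk(1) that(2)] that(1) by (simp add: f_def J_def)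
  have "const_term (\<psi> w) = 1"
  proof -
    have "w \<in> free_module (basis F 1)" using w(1) free_part_subset by blast
    from \<psi>[OF this] have "f * (aug F a - \<psi> w) \<in> J"
      by (simp add: w(2) a.scale right_diff_distrib mult.commute)
    from colon[OF this, of 0] show ?thesis using a(2) by (simp add: const_term_def lookup_minus)
  qed
  moreover have "const_term (\<psi> w') = 0"
  proof -
    have "w' \<in> free_module (basis F 1)" using w'(1) free_part_subset by blast
    from \<psi>[OF this] have diff: "f' * aug F a - \<psi> w' * f \<in> J" by (simp add: w'(2) a.scale)
    have "f' * aug F a \<in> J"
      using R.subspace_scale[OF subJ f'J, of "aug F a"] by (simp add: mult.commute)
    from R.subspace_diff[OF subJ this diff] have "f * \<psi> w' \<in> J" by (simp add: mult.commute)
    from colon[OF this, of 0] show ?thesis by (simp add: const_term_def)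
  qed
  \<comment> \<open>In both binomials \<open>- xz\<close> is the only term whose monomial divides \<open>xz\<close>, so multiplying by them
    turns the constant term, up to sign, into the coefficient of \<open>xz\<close>.\<close>
  ultimately have "coeff (\<psi> t) xz_monom = - 1"
    by (simp add: t_def \<psi>.diff \<psi>.scale lookup_minus f_def f'_def coeff_binomial_mult_xz)
  moreover have "coeff (\<psi> t) xz_monom = 0"
  proof -
    have d2: "module_hom scal scal (diff F 2)"
      using resolution_hom[OF res, of 1] by simp
    have "\<psi> t = (\<Sum>b\<in>Poly_Mapping.keys u'. coeff u' b * \<psi> (diff F 2 (monom b 1)))"
      unfolding u'(2)[symmetric]
      by (subst hom_eq_lin_ext[OF d2]) (simp add: lin_ext_def \<psi>.sum \<psi>.scale)
    moreover have "coeff (coeff u' b * \<psi> (diff F 2 (monom b 1))) xz_monom = 0"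
      if b: "b \<in> Poly_Mapping.keys u'" for b
    proof (rule coeff_mult_eq_0)
      let ?e = "monom b 1 :: nat \<Rightarrow>\<^sub>0 ('n diamond, 'k) mpoly"
      let ?v = "diff F 2 ?e"
      fix m m' :: "'n diamond \<Rightarrow>\<^sub>0 nat" assume m: "xz_monom = m + m'"
      have "b \<in> basis F 2" using b u'(1) by (auto simp: free_module_def)
      then have "?e \<in> free_part (basis F 2) (shift F 2) (shift F 2 b)"
        using free_part_monom[of b "basis F 2" "0 :: 'n diamond \<Rightarrow>\<^sub>0 nat" "1 :: 'k" "shift F 2"] by (simp add: mdeg_def)
      then have fr: "?e \<in> free_module (basis F 2)"
        and "?v \<in> free_part (basis F 1) (shift F 1) (shift F 2 b)"
        using resolution_degree[OF res, of 1 "shift F 2 b"] free_part_subset[of "basis F 2"] by auto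
      then have v: "?v \<in> free_module (basis F 1)" using free_part_subset by blast
      then have "diff F 1 ?v = 0"
        using resolution_exact[OF res, of ?v 0] fr by auto
      then have "- (\<psi> ?v * f) \<in> J" using \<psi>[OF v] by (simp add: a.zero)
      then have "f * \<psi> ?v \<in> J" using R.subspace_neg[OF subJ] by (fastforce simp: mult.commute)
      from colon[OF this] have "coeff (\<psi> ?v) m' = 0" if "m \<noteq> 0"
        using xz_monom_divisor[OF m[symmetric] that] by blast
      then show "coeff (coeff u' b) m = 0 \<or> coeff (\<psi> ?v) m' = 0"
        using u'(3)[of b] by (auto simp: const_term_def)
    qed
    ultimately show ?thesis by (simp add: lookup_sum)
  qed
  ultimately show False by simp
qed

theorem proposition1p8:
  fixes I :: "('n::finite diamond, 'k::field) mpoly set"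
  assumes "CARD('n) \<ge> 3"
    and "I = ideal_generated {Var (DY i) * Var (DY j) - Var DX * Var DZ | i j. i \<noteq> j}"
  shows "graded_betti I 2 4 > 0"
proof -
  interpret R: module "(*) :: ('n diamond, 'k) mpoly \<Rightarrow> _" by (rule module_times)
  have I: "I = ideal_generated {diamond_binomial i j | i j. i \<noteq> j}"
    using assms(2) by (simp add: diamond_binomial_def)
  have "\<exists>F. graded_free_resolution F I"
  proof (rule graded_free_resolution_exists)
    show "R.subspace I" by (simp add: I ideal_generated_def)
    show "homog_part j p \<in> I" if "p \<in> I" for p j
      using that unfolding I
      by (rule homog_part_ideal[where i = 2, rotated]) (auto simp: diamond_binomial_homog)
  qed
  then have res: "graded_free_resolution (SOME F. graded_free_resolution F I) I"
    by (rule someI_ex)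
  obtain i j k :: 'n where "i \<noteq> j" "i \<noteq> k" "j \<noteq> k"
  proof -
    obtain T :: "'n set" where "card T = 3" using assms(1) obtain_subset_with_card_n by metis
    then show ?thesis using that by (auto simp: card_3_iff)
  qed
  then have "\<not> tor_cycles (SOME F. graded_free_resolution F I) 2 4
      \<subseteq> tor_boundaries (SOME F. graded_free_resolution F I) 2 4"
    using diamond_tor_nonzero res unfolding I by blast
  then have "quotient_dim (tor_cycles (SOME F. graded_free_resolution F I) 2 4)
      (tor_boundaries (SOME F. graded_free_resolution F I) 2 4) > 0"
    using tor_boundaries_subset_cycles[OF res, of 1 4] subspace_tor_cycles[OF res, of 1 4]
      subspace_tor_boundaries[OF res, of 2 4]
    by (intro quotient_dim_pos) (auto simp: numeral_2_eq_2)
  then show ?thesis by (simp add: graded_betti_def Let_def)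
qed

end
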